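(* For every constant $C>0$ there is a constant $C'>0$ (depending only on $C$) such that the following holds. Let $D\geq 3$ and let $\chi$ be a real primitive Dirichlet character of conductor $D$, with Dirichlet $L$-function $L(s,\chi)=\sum_{n\geq 1}\chi(n)n^{-s}$. If $L(s,\chi)$ has a real zero $\beta<1$ with $$1-\beta\leq C\,(\log D)^{-3}\log\log D,$$ then $$L(1,\chi)\leq \frac{C'}{\log D}.$$
   Context: A real primitive character modulo $D$ is a primitive Dirichlet character of conductor $D$ taking only real values. *)

theory Defs
  imports "HOL-Complex_Analysis.Complex_Analysis"
begin

definition dirichlet_character :: "nat \<Rightarrow> (nat \<Rightarrow> complex) \<Rightarrow> bool" where
  "dirichlet_character D chi \<longleftrightarrow>
     D > 0 \<and>
     (\<forall>m n. chi (m * n) = chi m * chi n) \<and>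
     (\<forall>n. chi (n + D) = chi n) \<and>
     (\<forall>n. chi n \<noteq> 0 \<longleftrightarrow> coprime n D)"

definition conductor :: "nat \<Rightarrow> (nat \<Rightarrow> complex) \<Rightarrow> nat" where
  "conductor D chi =
     (LEAST d. d dvd D \<and> (\<exists>\<psi>. dirichlet_character d \<psi> \<and> (\<forall>n. coprime n D \<longrightarrow> chi n = \<psi> n)))"

definition primitive_character :: "nat \<Rightarrow> (nat \<Rightarrow> complex) \<Rightarrow> bool" where
  "primitive_character D chi \<longleftrightarrow> dirichlet_character D chi \<and> conductor D chi = D"

definition real_primitive_character :: "nat \<Rightarrow> (nat \<Rightarrow> complex) \<Rightarrow> bool" where
  "real_primitive_character D chi \<longleftrightarrow> primitive_character D chi \<and> (\<forall>n. chi n \<in> \<real>)"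

text \<open>
  The Dirichlet series extends to an entire function for every non-principal character.
  The value of this extension at \<open>s\<close> is read off from the holomorphic continuation of the
  series to any right half-plane containing \<open>s\<close>; it does not depend on the half-plane
  (lemma \<open>dirichlet_L_eqI\<close> below).
\<close>

definition dirichlet_L_on :: "(nat \<Rightarrow> complex) \<Rightarrow> real \<Rightarrow> (complex \<Rightarrow> complex) \<Rightarrow> bool" where
  "dirichlet_L_on chi a f \<longleftrightarrow>
     f holomorphic_on {z. Re z > a} \<and>
     (\<forall>z. Re z > 1 \<longrightarrow> (\<lambda>n. chi (Suc n) * of_nat (Suc n) powr (- z)) sums f z)"

definition dirichlet_L :: "(nat \<Rightarrow> complex) \<Rightarrow> complex \<Rightarrow> complex" where
  "dirichlet_L chi s = (THE w. \<exists>a f. a < Re s \<and> dirichlet_L_on chi a f \<and> w = f s)"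

lemma dirichlet_L_on_unique:
  assumes f: "dirichlet_L_on chi a f" and g: "dirichlet_L_on chi b g"
    and s: "a < Re s" "b < Re s"
  shows "f s = g s"
proof -
  define c where "c = max a b"
  define d where "d = max c 1"
  have ne: "{z. Re z > d} \<noteq> {}"
  proof -
    have "complex_of_real (d + 1) \<in> {z. Re z > d}" by simp
    thus ?thesis by blast
  qed
  have hf: "f holomorphic_on {z. Re z > c}" and hg: "g holomorphic_on {z. Re z > c}"
    using f g unfolding dirichlet_L_on_def c_def
    by (auto elim!: holomorphic_on_subset)
  have eq: "f z = g z" if "z \<in> {z. Re z > d}" for z
    using f g that unfolding dirichlet_L_on_def d_def by (auto intro: sums_unique2)
  show ?thesis
  proof (rule analytic_continuation_open[OF _ _ ne _ _ hf hg eq])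
    show "connected {z. Re z > c}"
      by (intro convex_connected convex_halfspace_Re_gt)
    show "open {z. Re z > d}" "open {z. Re z > c}"
      by (rule open_halfspace_Re_gt)+
  qed (use s in \<open>auto simp: c_def d_def\<close>)
qed

lemma dirichlet_L_eqI:
  assumes "dirichlet_L_on chi a f" "a < Re s"
  shows "dirichlet_L chi s = f s"
  unfolding dirichlet_L_def
  by (rule the_equality) (use assms dirichlet_L_on_unique in blast)+

end

theory Submission
  imports Defs "HOL-Number_Theory.Residues" "HOL-Real_Asymp.Real_Asymp"
begin

text \<open>
  Let \<open>r = 1 * \<chi> \<ge> 0\<close>, \<open>S x = \<Sum>n\<le>x. r n / n\<close>, \<open>\<delta> = 1 - \<beta>\<close> and \<open>l = log D\<close>.
  Since \<open>L(\<beta>, \<chi>) = 0\<close>, the hyperbola method gives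
  \<open>\<Sum>n\<le>x. r n / n^\<beta> = L(1, \<chi>) x^\<delta> / \<delta> + error\<close> with a power saving error once \<open>x \<ge> Q = D^40\<close>,
  uniformly in \<open>\<delta>\<close>. Hence \<open>L(1, \<chi>) \<lless> \<delta> S Q\<close>, and \<open>S\<close> is nearly constant beyond \<open>Q\<close>:
  \<open>S (Q^J) - S Q \<le> S Q / l\<close> for slowly growing \<open>J\<close>.
  The trivial bound \<open>S Q \<lless> l^2\<close> misses the claim by a factor \<open>log l\<close>. To gain it, let
  \<open>u \<approx> sqrt (log l)\<close> and \<open>w = D^(1/u)\<close>. If the primes \<open>p\<close> in \<open>(w, Q]\<close> with \<open>\<chi> p \<ge> 0\<close> had
  \<open>\<Sum> 1/p \<ge> 1\<close>, then multiplying the integers up to \<open>Q\<close> by \<open>k = 40 u\<close> such primes would produce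
  integers beyond \<open>Q\<close> carrying a proportion at least \<open>(k+1)^(-2k)\<close> of the mass \<open>S Q\<close>, more than
  \<open>1/l\<close>. So this prime sum is below 1, and the Euler product yields
  \<open>S Q \<lless> (log w)^2 = (l/u)^2 \<le> l^2 / log l\<close>.
\<close>

section \<open>Sums over primes\<close>

lemma sum_split_greaterThanAtMost:
  fixes f :: "nat \<Rightarrow> real"
  assumes "N \<le> K"
  shows "sum f {1..K} = sum f {1..N} + sum f {N<..K}"
proof -
  have "{1..K} = {1..N} \<union> {N<..K}" using assms by auto
  moreover have "{1..N} \<inter> {N<..K} = {}" by auto
  ultimately show ?thesis by (simp only: sum.union_disjoint finite_atLeastAtMost finite_greaterThanAtMost)
qed

text \<open>Comparison with the integral of \<open>t powr - s\<close>. The induction carries the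
  tail \<open>(M + 1) powr (1 - s) / (s - 1)\<close> along, because the bare bound does not
  propagate.\<close>

lemma sum_powr_le:
  fixes s :: real
  assumes "s > 1"
  shows "(\<Sum>n=1..M. real n powr - s) \<le> 1 + 1 / (s - 1)"
proof -
  have "(\<Sum>n=1..Suc M. real n powr - s) \<le> 1 + 1 / (s - 1) - real (Suc M) powr (1 - s) / (s - 1)" for M
  proof (induction M)
    case 0
    then show ?case by simp
  next
    case (Suc M)
    define f where "f = (\<lambda>t::real. - (t powr (1 - s) / (s - 1)))"
    have "\<exists>z>real (Suc M). z < real (Suc (Suc M)) \<and>
        f (real (Suc (Suc M))) - f (real (Suc M)) = (real (Suc (Suc M)) - real (Suc M)) * (z powr - s)"
    proof (rule MVT2)
      fix x assume x: "real (Suc M) \<le> x" "x \<le> real (Suc (Suc M))"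
      hence "x > 0" by simp
      thus "(f has_real_derivative x powr - s) (at x)"
        unfolding f_def
        by (rule DERIV_cong[OF DERIV_minus[OF DERIV_cdivide[OF has_real_derivative_powr]]])
          (use assms in \<open>simp_all add: field_simps\<close>)
    qed simp
    then obtain z where z: "z > real (Suc M)" "z < real (Suc (Suc M))"
      and eq: "f (real (Suc (Suc M))) - f (real (Suc M)) = z powr - s" by auto
    have "real (Suc (Suc M)) powr - s \<le> z powr - s"
      using z assms by (intro powr_mono2') auto
    with eq Suc show ?case unfolding f_def by simp
  qed
  from this[of M] have "(\<Sum>n=1..Suc M. real n powr - s) \<le> 1 + 1 / (s - 1)"
    by (rule order_trans) (use assms in simp)
  moreover have "(\<Sum>n=1..M. real n powr - s) \<le> (\<Sum>n=1..Suc M. real n powr - s)" by simp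
  ultimately show ?thesis by linarith
qed

text \<open>Telescoping, as \<open>1/n^2\<close> is at most \<open>1/(n-1) - 1/n\<close>. The bound
  later absorbs the second-order terms of sums over primes.\<close>

lemma sum_inverse_squares_le:
  assumes "finite A" "\<And>n. n \<in> A \<Longrightarrow> n \<ge> (2::nat)"
  shows "(\<Sum>n\<in>A. 1 / real n ^ 2) \<le> 1"
proof -
  have bd: "(\<Sum>n=2..<M + 2. 1 / real n ^ 2) \<le> 1 - 1 / real (M + 1)" for M
  proof (induction M)
    case (Suc M)
    have "1 / real (M + 2) ^ 2 \<le> 1 / (real (M + 1) * real (M + 2))"
      by (intro divide_left_mono) (auto simp: power2_eq_square)
    also have "\<dots> = 1 / real (M + 1) - 1 / real (M + 2)" by (simp add: field_simps)
    finally show ?case using Suc by (simp add: add_ac)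
  qed simp
  obtain M where M: "\<forall>n\<in>A. n < M" using assms(1) finite_nat_set_iff_bounded by blast
  have "(\<Sum>n\<in>A. 1 / real n ^ 2) \<le> (\<Sum>n=2..<M + 2. 1 / real n ^ 2)"
    using assms M by (intro sum_mono2) fastforce+
  also have "\<dots> \<le> 1" by (rule order_trans[OF bd]) simp
  finally show ?thesis .
qed

text \<open>A set of primes is recovered from its product as the set of prime divisors.\<close>

lemma inj_on_prod_sets_of_primes:
  assumes "\<And>p. p \<in> F \<Longrightarrow> prime (p::nat)" "finite F"
  shows "inj_on (\<lambda>A. \<Prod>A) (Pow F)"
proof (rule inj_onI)
  fix A B assume AB: "A \<in> Pow F" "B \<in> Pow F" and eq: "\<Prod>A = \<Prod>B"
  have "{p. prime p \<and> p dvd \<Prod>A} = A" if "A \<in> Pow F" for A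
  proof -
    have fin: "finite A" and pr: "\<And>p. p \<in> A \<Longrightarrow> prime p" using that assms finite_subset by auto
    show ?thesis
    proof (intro equalityI subsetI)
      fix p assume "p \<in> {p. prime p \<and> p dvd \<Prod>A}"
      then obtain q where "q \<in> A" "prime p" "p dvd q" using prime_dvd_prod_iff[OF fin, of p "\<lambda>x. x"] by auto
      thus "p \<in> A" using pr[of q] primes_dvd_imp_eq[of p q] by simp
    qed (use fin pr in \<open>auto intro: dvd_prod_eqI\<close>)
  qed
  note supp = this
  have "A = {p. prime p \<and> p dvd \<Prod>A}" by (rule supp[OF AB(1), symmetric])
  also have "\<dots> = {p. prime p \<and> p dvd \<Prod>B}" by (simp only: eq)
  also have "\<dots> = B" by (rule supp[OF AB(2)])
  finally show "A = B" .
qed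

text \<open>Expanding the product yields \<open>n powr - s\<close> for distinct squarefree
  \<open>n\<close>, hence a part of the zeta series. Factors \<open>1 + p powr - s\<close> in place
  of full Euler factors keep the expansion finite.\<close>

lemma prod_primes_powr_le:
  fixes s :: real
  assumes "\<And>p. p \<in> F \<Longrightarrow> prime (p::nat)" "finite F" "s > 1"
  shows "(\<Prod>p\<in>F. 1 + real p powr - s) \<le> 1 + 1 / (s - 1)"
proof -
  have fin: "finite ((\<lambda>A. \<Prod>A) ` Pow F)" using assms(2) by simp
  obtain M where M: "\<forall>n\<in>(\<lambda>A. \<Prod>A) ` Pow F. n < M" using fin finite_nat_set_iff_bounded by blast
  have "(\<Prod>p\<in>F. 1 + real p powr - s) = (\<Sum>A\<in>Pow F. \<Prod>p\<in>A. real p powr - s)"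
    using prod_add[OF assms(2), of "\<lambda>p. real p powr - s" "\<lambda>_. 1"] by (simp add: add.commute)
  also have "\<dots> = (\<Sum>A\<in>Pow F. real (\<Prod>A) powr - s)"
    by (intro sum.cong refl) (simp add: prod_powr_distrib)
  also have "\<dots> = (\<Sum>n\<in>(\<lambda>A. \<Prod>A) ` Pow F. real n powr - s)"
    by (subst sum.reindex[OF inj_on_prod_sets_of_primes[OF assms(1,2)]]) auto
  also have "\<dots> \<le> (\<Sum>n=1..M. real n powr - s)"
  proof (rule sum_mono2)
    show "(\<lambda>A. \<Prod>A) ` Pow F \<subseteq> {1..M}"
    proof
      fix n assume n: "n \<in> (\<lambda>A. \<Prod>A) ` Pow F"
      then obtain A where A: "A \<subseteq> F" "n = \<Prod>A" by auto
      have "n > 0" unfolding A(2) using A(1) assms(1) by (intro prod_pos) (auto simp: prime_gt_0_nat)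
      with M n show "n \<in> {1..M}" by (auto intro: less_imp_le)
    qed
  qed auto
  also have "\<dots> \<le> 1 + 1 / (s - 1)" by (rule sum_powr_le[OF assms(3)])
  finally show ?thesis .
qed

lemma card_multiples_ge:
  assumes "p > (0::nat)"
  shows "m div p \<le> card {n\<in>{1..m}. p dvd n}"
proof -
  have "card ((\<lambda>k. p * k) ` {1..m div p}) = m div p"
    using assms by (subst card_image) (auto simp: inj_on_def)
  moreover have "(\<lambda>k. p * k) ` {1..m div p} \<subseteq> {n\<in>{1..m}. p dvd n}"
    using assms by (auto simp: less_eq_div_iff_mult_less_eq mult.commute)
  ultimately show ?thesis by (metis card_mono finite_Collect_conjI finite_atLeastAtMost Collect_mem_eq)
qed

lemma prod_primes_dvd:
  assumes "finite A" "\<And>p. p \<in> A \<Longrightarrow> prime p \<and> p dvd (n::nat)"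
  shows "\<Prod>A dvd n"
  using assms
proof (induction A rule: finite_induct)
  case (insert p A)
  have "coprime p (\<Prod>A)"
  proof (rule prod_coprime_right)
    fix q assume "q \<in> A"
    with insert show "coprime p q" by (intro primes_coprime) auto
  qed
  with insert show ?case by (auto intro: divides_mult)
qed simp

text \<open>The product of the distinct prime divisors divides \<open>n\<close>.\<close>

lemma sum_ln_prime_divisors_le:
  assumes "n > (0::nat)"
  shows "(\<Sum>p | prime p \<and> p dvd n. ln (real p)) \<le> ln (real n)"
proof -
  have fin: "finite {p. prime p \<and> p dvd n}" using assms by (auto intro: finite_subset[OF _ finite_divisors_nat[OF assms]])
  have "(\<Prod>p | prime p \<and> p dvd n. p) dvd n"
    using prod_primes_dvd[OF fin, of n] by simp
  hence le: "(\<Prod>p | prime p \<and> p dvd n. p) \<le> n" using assms by (intro dvd_imp_le)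
  have "(\<Sum>p | prime p \<and> p dvd n. ln (real p)) = ln (\<Prod>p | prime p \<and> p dvd n. real p)"
    using fin by (subst ln_prod) (auto simp: prime_gt_0_nat)
  also have "\<dots> \<le> ln (real n)"
  proof (subst ln_le_cancel_iff)
    show "(\<Prod>p | prime p \<and> p dvd n. real p) > 0" by (intro prod_pos) (auto simp: prime_gt_0_nat)
    show "(\<Prod>p | prime p \<and> p dvd n. real p) \<le> real n" using of_nat_mono[OF le, where 'a = real] by simp
  qed (use assms in auto)
  finally show ?thesis .
qed

text \<open>Double counting in the style of Chebyshev and Mertens: the pairs \<open>(p, n)\<close>
  with \<open>p dvd n\<close> and \<open>n \<le> m\<close>, weighted by \<open>ln p\<close>, are
  summed in both orders.\<close>

lemma sum_ln_prime_div_le: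
  "(\<Sum>p | prime p \<and> p \<le> m. ln (real p) / real p) \<le> 2 * ln (real m)"
proof (cases "m = 0")
  case True
  then have "{p::nat. prime p \<and> p \<le> m} = {}" by auto
  then show ?thesis using True by simp
next
  case False
  define F where "F = {p::nat. prime p \<and> p \<le> m}"
  have finF: "finite F" unfolding F_def by simp
  have "real m / 2 * (\<Sum>p\<in>F. ln (real p) / real p) = (\<Sum>p\<in>F. real m / (2 * real p) * ln (real p))"
    by (simp add: sum_distrib_left field_simps)
  also have "\<dots> \<le> (\<Sum>p\<in>F. real (card {n\<in>{1..m}. p dvd n}) * ln (real p))"
  proof (rule sum_mono)
    fix p assume p: "p \<in> F"
    hence p0: "p > 1" "p \<le> m" using prime_gt_1_nat by (auto simp: F_def)
    \<comment> \<open>Rounding \<open>m / p\<close> down loses at most a factor 2, since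
      \<open>m div p\<close> is at least 1.\<close>
    have "m < p * (m div p) + p" using p0 by (metis dividend_less_times_div mult.commute add.commute gr_zeroI not_one_less_zero)
    moreover have "p \<le> p * (m div p)" using div_le_mono[of p m p] p0 by simp
    ultimately have "m \<le> 2 * p * (m div p)" by linarith
    hence "real m \<le> 2 * real p * real (m div p)" by (metis of_nat_le_iff of_nat_mult of_nat_numeral)
    hence "real m / (2 * real p) \<le> real (m div p)" using p0 by (simp add: field_simps)
    also have "\<dots> \<le> real (card {n\<in>{1..m}. p dvd n})" using card_multiples_ge[of p m] p0 by simp
    finally show "real m / (2 * real p) * ln (real p) \<le> real (card {n\<in>{1..m}. p dvd n}) * ln (real p)"
      using p0 by (intro mult_right_mono) auto
  qed
  also have "\<dots> = (\<Sum>p\<in>F. \<Sum>n | n \<in> {1..m} \<and> p dvd n. ln (real p))" by simp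
  also have "\<dots> = (\<Sum>n\<in>{1..m}. \<Sum>p | p \<in> F \<and> p dvd n. ln (real p))"
    using finF by (intro sum.swap_restrict) auto
  also have "\<dots> \<le> (\<Sum>n\<in>{1..m}. ln (real m))"
  proof (rule sum_mono)
    fix n assume n: "n \<in> {1..m}"
    hence "{p \<in> F. p dvd n} = {p. prime p \<and> p dvd n}" by (auto simp: F_def dest: dvd_imp_le)
    hence "(\<Sum>p | p \<in> F \<and> p dvd n. ln (real p)) \<le> ln (real n)"
      using sum_ln_prime_divisors_le[of n] n by simp
    also have "\<dots> \<le> ln (real m)" using n by simp
    finally show "(\<Sum>p | p \<in> F \<and> p dvd n. ln (real p)) \<le> ln (real m)" .
  qed
  finally have "real m / 2 * (\<Sum>p\<in>F. ln (real p) / real p) \<le> real m * ln (real m)" by simp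
  hence "(\<Sum>p\<in>F. ln (real p) / real p) \<le> 2 * ln (real m)"
    using False by (simp add: field_simps)
  thus ?thesis by (simp only: F_def)
qed

text \<open>Upper half of Mertens' second theorem. At \<open>s = 1 + 1 / ln m\<close> the zeta bound
  is \<open>1 + ln m\<close>. Passing from \<open>p powr - s\<close> to \<open>1 / p\<close> costs
  \<open>(s - 1) * ln p / p\<close>, in total at most 2 by the preceding lemma; the third unit comes
  from the squares in the expansion of \<open>ln (1 + p powr - s)\<close>.\<close>

lemma sum_inverse_primes_le:
  assumes "m \<ge> (2::nat)"
  shows "(\<Sum>p | prime p \<and> p \<le> m. 1 / real p) \<le> ln (1 + ln (real m)) + 3"
proof -
  define F where "F = {p::nat. prime p \<and> p \<le> m}"
  define s where "s = 1 + 1 / ln (real m)"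
  have lm: "ln (real m) > 0" using assms by simp
  have s: "s > 1" "1 / (s - 1) = ln (real m)" using lm by (auto simp: s_def)
  have finF: "finite F" unfolding F_def by simp
  have F2: "p \<ge> 2" if "p \<in> F" for p using that by (auto simp: F_def prime_ge_2_nat)
  have "(\<Sum>p\<in>F. real p powr - s - 1 / real p ^ 2) \<le> (\<Sum>p\<in>F. ln (1 + real p powr - s))"
  proof (rule sum_mono)
    fix p assume p: "p \<in> F"
    define t where "t = real p powr - s"
    have p2: "real p \<ge> 2" using F2[OF p] by simp
    have "t \<le> real p powr - 1" unfolding t_def using s p2 by (intro powr_mono) auto
    hence t: "t \<ge> 0" "t \<le> 1 / real p" using p2 by (auto simp: t_def powr_minus field_simps)
    have "1 / real p \<le> 1" using p2 by simp
    hence "t \<le> 1" using t(2) by linarith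
    have "t^2 \<le> 1 / real p ^ 2" using power_mono[OF t(2,1), of 2] by (simp add: power_divide)
    moreover have "t - t^2 \<le> ln (1 + t)" using t \<open>t \<le> 1\<close> by (intro ln_one_plus_pos_lower_bound)
    ultimately show "real p powr - s - 1 / real p ^ 2 \<le> ln (1 + real p powr - s)"
      unfolding t_def[symmetric] by linarith
  qed
  also have "\<dots> = ln (\<Prod>p\<in>F. 1 + real p powr - s)"
    using finF by (subst ln_prod) (auto simp: add_nonneg_eq_0_iff)
  also have "\<dots> \<le> ln (1 + ln (real m))"
  proof (subst ln_le_cancel_iff)
    show "(\<Prod>p\<in>F. 1 + real p powr - s) \<le> 1 + ln (real m)"
      using prod_primes_powr_le[of F s] finF s by (simp add: F_def)
  qed (use lm in \<open>auto intro!: prod_pos add_pos_nonneg\<close>)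
  finally have 1: "(\<Sum>p\<in>F. real p powr - s) \<le> ln (1 + ln (real m)) + 1"
    using sum_inverse_squares_le[OF finF F2] by (simp add: sum_subtractf)
  have "(\<Sum>p\<in>F. 1 / real p) \<le> (\<Sum>p\<in>F. real p powr - s + (s - 1) * (ln (real p) / real p))"
  proof (rule sum_mono)
    fix p assume p: "p \<in> F"
    have p2: "real p \<ge> 2" using F2[OF p] by simp
    have "real p powr - s = exp (- ((s - 1) * ln (real p))) / real p"
      using p2 by (simp add: powr_def field_simps exp_diff exp_minus exp_add[symmetric])
    moreover have "exp (- ((s - 1) * ln (real p))) \<ge> 1 - (s - 1) * ln (real p)"
      using exp_ge_add_one_self[of "- ((s - 1) * ln (real p))"] by simp
    ultimately have "real p powr - s \<ge> (1 - (s - 1) * ln (real p)) / real p"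
      using p2 by (simp add: divide_right_mono)
    thus "1 / real p \<le> real p powr - s + (s - 1) * (ln (real p) / real p)"
      by (simp add: diff_divide_distrib)
  qed
  also have "\<dots> = (\<Sum>p\<in>F. real p powr - s) + (s - 1) * (\<Sum>p\<in>F. ln (real p) / real p)"
    by (simp add: sum.distrib sum_distrib_left)
  also have "\<dots> \<le> (ln (1 + ln (real m)) + 1) + (s - 1) * (2 * ln (real m))"
    using 1 s sum_ln_prime_div_le[of m] by (intro add_mono mult_left_mono) (auto simp: F_def)
  also have "(s - 1) * (2 * ln (real m)) = 2" using lm by (simp add: s_def)
  finally show ?thesis by (simp add: F_def)
qed

section \<open>The convolution of a real character with the constant function\<close>

lemma inj_on_mult_coprime_divisors:
  assumes "coprime a (b::nat)"
  shows "inj_on (\<lambda>(x, y). x * y) ({x. x dvd a} \<times> {y. y dvd b})"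
proof (rule inj_onI, clarify)
  fix x y x' y' assume dv: "x dvd a" "y dvd b" "x' dvd a" "y' dvd b" and eq: "x * y = x' * y'"
  have co: "coprime u v" if "u dvd a" "v dvd b" for u v
    using assms that by (meson coprime_divisors)
  have "x dvd x'" using co[OF dv(1,4)] eq by (metis coprime_dvd_mult_left_iff dvd_triv_left)
  moreover have "x' dvd x" using co[OF dv(3,2)] eq by (metis coprime_dvd_mult_left_iff dvd_triv_left)
  moreover have "y dvd y'" using co[OF dv(3,2)] eq by (metis coprime_commute coprime_dvd_mult_right_iff dvd_triv_right)
  moreover have "y' dvd y" using co[OF dv(1,4)] eq by (metis coprime_commute coprime_dvd_mult_right_iff dvd_triv_right)
  ultimately show "x = x' \<and> y = y'" by (simp add: dvd_antisym)
qed

lemma divisors_mult_eq_image: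
  "(\<lambda>(x, y). x * y) ` ({x. x dvd a} \<times> {y. y dvd b}) = {d. d dvd a * (b::nat)}"
  by (fastforce elim: dvd_productE intro: mult_dvd_mono)

lemma prime_power_decomposition:
  assumes "prime (p::nat)" "n > 0"
  obtains j m where "n = p ^ j * m" "\<not> p dvd m" "coprime (p ^ j) m" "m > 0"
proof -
  obtain m where m: "n = p ^ multiplicity p n * m" "\<not> p dvd m"
    using multiplicity_decompose'[of n p] assms by (metis not_prime_unit less_numeral_extra(3))
  have "coprime (p ^ multiplicity p n) m"
    using assms(1) m(2) by (simp add: prime_imp_coprime)
  moreover have "m > 0" using m assms by (intro gr0I) auto
  ultimately show ?thesis using that m by blast
qed

section \<open>Series bounds for Euler factors\<close>

lemma sum_mult_power_le:
  fixes t :: real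
  assumes "0 \<le> t" "t < 1"
  shows "(\<Sum>j\<le>M. (real j + 1) * t ^ j) \<le> 1 / (1 - t)\<^sup>2"
proof -
  have s: "(\<lambda>j. of_nat (Suc j) * t ^ j) sums (1 / (1 - t)\<^sup>2)"
    using geometric_deriv_sums[of t] assms by simp
  have "(\<Sum>j\<in>{..M}. (real j + 1) * t ^ j) \<le> (\<Sum>j. (real j + 1) * t ^ j)"
    using assms s by (intro sum_le_suminf) (auto simp: sums_iff add_ac)
  thus ?thesis using s by (simp add: sums_iff add_ac)
qed

lemma sum_even_power_le:
  fixes t :: real
  assumes "0 \<le> t" "t < 1"
  shows "(\<Sum>j\<le>M. (if even j then 1 else 0) * t ^ j) \<le> 1 / (1 - t\<^sup>2)"
proof -
  have t2: "t\<^sup>2 < 1" using assms by (simp add: abs_square_less_1)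
  have "(\<Sum>j\<le>M. (if even j then 1 else 0) * t ^ j) = (\<Sum>j\<in>{j\<in>{..M}. even j}. t ^ j)"
    by (subst sum.inter_filter) (auto intro!: sum.cong)
  also have "\<dots> \<le> (\<Sum>j\<in>(\<lambda>i. 2 * i) ` {..M}. t ^ j)"
    using assms by (intro sum_mono2) (auto elim!: evenE)
  also have "\<dots> = (\<Sum>i\<le>M. (t\<^sup>2) ^ i)"
    by (subst sum.reindex) (auto simp: inj_on_def power_mult)
  also have "\<dots> \<le> (\<Sum>i. (t\<^sup>2) ^ i)" using t2 by (intro sum_le_suminf) auto
  also have "\<dots> = 1 / (1 - t\<^sup>2)" using t2 by (intro suminf_geometric) auto
  finally show ?thesis .
qed

text \<open>Puts Euler factors into exponential form, so that their product becomes a sum over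
  primes.\<close>

lemma inverse_one_minus_le_exp:
  fixes t :: real
  assumes "0 \<le> t" "t \<le> 1/2"
  shows "1 / (1 - t) \<le> exp (t + t\<^sup>2)"
proof -
  \<comment> \<open>The second factor is the quadratic Taylor polynomial of \<open>exp\<close> at
    \<open>t + t^2\<close>, a lower bound for nonnegative arguments.\<close>
  have "(1 - t) * (1 + (t + t\<^sup>2) + (t + t\<^sup>2)\<^sup>2 / 2) \<ge> 1"
  proof -
    have "(1 - t) * (1 + (t + t\<^sup>2) + (t + t\<^sup>2)\<^sup>2 / 2) - 1 = t\<^sup>2 / 2 * (1 - t - t\<^sup>2 - t ^ 3)"
      by (simp add: power2_eq_square power3_eq_cube field_simps)
    moreover have "t\<^sup>2 \<le> (1/2)\<^sup>2" "t ^ 3 \<le> (1/2) ^ 3" using assms by (auto intro!: power_mono)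
    hence "1 - t - t\<^sup>2 - t ^ 3 \<ge> 0" using assms by (simp add: power2_eq_square power3_eq_cube)
    hence "t\<^sup>2 / 2 * (1 - t - t\<^sup>2 - t ^ 3) \<ge> 0" by (intro mult_nonneg_nonneg) auto
    ultimately show ?thesis by linarith
  qed
  also have "(1 - t) * (1 + (t + t\<^sup>2) + (t + t\<^sup>2)\<^sup>2 / 2) \<le> (1 - t) * exp (t + t\<^sup>2)"
    using assms by (intro mult_left_mono exp_lower_Taylor_quadratic) auto
  finally show ?thesis using assms by (simp add: field_simps)
qed

text \<open>The real arithmetic kernel of the proof: periodicity and nonprincipality of the
  character are condensed into the bound on its partial sums.\<close>

locale real_character =
  fixes D :: nat and c :: "nat \<Rightarrow> real"
  assumes D_ge_1: "D \<ge> 1"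
    and c_mult: "c (m * n) = c m * c n"
    and c_one: "c 1 = 1"
    and c_values: "c n \<in> {-1, 0, 1}"
    and abs_sum_c_le: "\<bar>\<Sum>n=1..N. c n\<bar> \<le> real D"
begin

text \<open>The coefficients of the Dirichlet series of \<open>zeta(s) * L(s, chi)\<close>.\<close>

definition r :: "nat \<Rightarrow> real" where
  "r n = (\<Sum>d | d dvd n. c d)"

lemma abs_c_le_1: "\<bar>c n\<bar> \<le> 1"
  using c_values[of n] by auto

lemma c_power: "c (p ^ i) = c p ^ i"
  by (induction i) (use c_one in \<open>auto simp: c_mult\<close>)

lemma r_mult_coprime:
  assumes "coprime a b"
  shows "r (a * b) = r a * r b"
proof -
  have "r (a * b) = (\<Sum>d \<in> (\<lambda>(x, y). x * y) ` ({x. x dvd a} \<times> {y. y dvd b}). c d)"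
    by (simp add: r_def divisors_mult_eq_image)
  also have "\<dots> = (\<Sum>(x, y) \<in> {x. x dvd a} \<times> {y. y dvd b}. c x * c y)"
    by (subst sum.reindex[OF inj_on_mult_coprime_divisors[OF assms]])
      (auto simp: c_mult case_prod_unfold)
  also have "\<dots> = r a * r b"
    by (simp add: r_def sum_product sum.cartesian_product)
  finally show ?thesis .
qed

lemma r_one: "r 1 = 1"
  using c_one by (simp add: r_def)

lemma r_prime_power:
  assumes "prime p"
  shows "r (p ^ j) = (\<Sum>i\<le>j. c p ^ i)"
proof -
  have "{d. d dvd p ^ j} = (\<lambda>i. p ^ i) ` {..j}"
    using assms by (auto simp: divides_primepow_nat le_imp_power_dvd)
  moreover have "inj_on (\<lambda>i. p ^ i) {..j}"
    using prime_gt_1_nat[OF assms] by (auto simp: inj_on_def)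
  ultimately show ?thesis by (simp add: r_def sum.reindex c_power)
qed

lemma r_prime_power_cases:
  assumes "prime p"
  shows "c p = 1 \<Longrightarrow> r (p ^ j) = real j + 1"
    and "c p = 0 \<Longrightarrow> r (p ^ j) = 1"
    and "c p = -1 \<Longrightarrow> r (p ^ j) = (if even j then 1 else 0)"
proof -
  show "c p = 1 \<Longrightarrow> r (p ^ j) = real j + 1" by (simp add: r_prime_power[OF assms])
  show "c p = 0 \<Longrightarrow> r (p ^ j) = 1" 
    by (simp add: r_prime_power[OF assms] power_0_left)
  assume c: "c p = -1"
  have "(\<Sum>i\<le>j. (-1::real) ^ i) = (if even j then 1 else 0)" by (induction j) auto
  with c show "r (p ^ j) = (if even j then 1 else 0)" by (simp add: r_prime_power[OF assms])
qed

lemma r_prime_power_bounds: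
  assumes "prime p"
  shows "r (p ^ j) \<ge> 0" "r (p ^ j) \<le> real j + 1"
  using r_prime_power_cases[OF assms, of j] c_values[of p] by auto

text \<open>Induction that peels off the full power of one prime; multiplicativity reduces the sign
  to prime powers.\<close>

lemma r_nonneg: "n > 0 \<Longrightarrow> r n \<ge> 0"
proof (induction n rule: less_induct)
  case (less n)
  show ?case
  proof (cases "n = 1")
    case False
    then obtain p where p: "prime p" "p dvd n" using prime_factor_nat by blast
    obtain j m where n: "n = p ^ j * m" "\<not> p dvd m" "coprime (p ^ j) m" "m > 0"
      using prime_power_decomposition[OF p(1) less.prems] .
    have "j > 0" using p(2) n(1,2) by (cases j) auto
    hence "1 < p ^ j" using prime_gt_1_nat[OF p(1)] by (intro one_less_power)
    hence "m < n" using n(1,4) by simp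
    hence "r m \<ge> 0" using less.IH n(4) by blast
    thus ?thesis using r_prime_power_bounds(1)[OF p(1), of j] by (simp add: n(1) r_mult_coprime[OF n(3)])
  qed (use r_one in simp)
qed

text \<open>One more factor \<open>p\<close> only adds the nonnegative term
  \<open>c p ^ (j + 1)\<close> to the local sum. This is why multiplication by such primes preserves
  the mass of \<open>r\<close>.\<close>

lemma r_mult_prime_ge:
  assumes "prime p" "c p \<ge> 0" "n > 0"
  shows "r n \<le> r (n * p)"
proof -
  obtain j m where n: "n = p ^ j * m" "\<not> p dvd m" "coprime (p ^ j) m" "m > 0"
    using prime_power_decomposition[OF assms(1,3)] .
  have "coprime (p ^ Suc j) m" using assms(1) n(2) using prime_imp_coprime by (auto simp del: power_Suc)
  moreover have "n * p = p ^ Suc j * m" using n(1) by simp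
  ultimately have "r (n * p) = r (p ^ Suc j) * r m" using r_mult_coprime by metis
  moreover have "r (p ^ j) \<le> r (p ^ Suc j)"
    using assms(2) unfolding r_prime_power[OF assms(1)] by simp
  ultimately show ?thesis
    using r_nonneg[OF n(4)] by (simp add: n(1) r_mult_coprime[OF n(3)] mult_right_mono)
qed

section \<open>Euler product bound for the logarithmic sum\<close>

text \<open>Splitting off the exact power of \<open>p\<close> embeds the index set into pairs
  \<open>(j, m)\<close>. Enlarging to all pairs with \<open>j \<le> M\<close> and
  \<open>m \<le> M\<close> is harmless since \<open>r\<close> is nonnegative.\<close>

lemma sum_r_div_insert_prime_le:
  assumes p: "prime p" and F: "\<And>q. q \<in> F \<Longrightarrow> prime q" "p \<notin> F"
  shows "(\<Sum>n | 0 < n \<and> n \<le> M \<and> prime_factors n \<subseteq> insert p F. r n / real n) \<le>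
     (\<Sum>j\<le>M. r (p ^ j) / real p ^ j) * (\<Sum>n | 0 < n \<and> n \<le> M \<and> prime_factors n \<subseteq> F. r n / real n)"
    (is "sum ?f ?A \<le> ?e * sum ?f ?B")
proof -
  have finB: "finite ?B" "finite ?A" by auto
  have "sum ?f ?A \<le> sum ?f ((\<lambda>(j, m). p ^ j * m) ` ({..M} \<times> ?B))"
  proof (rule sum_mono2)
    show "?A \<subseteq> (\<lambda>(j, m). p ^ j * m) ` ({..M} \<times> ?B)"
    proof
      fix n assume n: "n \<in> ?A"
      then obtain j m where n': "n = p ^ j * m" "\<not> p dvd m" "coprime (p ^ j) m" "m > 0"
        using prime_power_decomposition[OF p] by blast
      \<comment> \<open>The crude bound \<open>j < p ^ j \<le> n\<close> suffices to keep the
        exponent in range.\<close>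
      have "j < p ^ j" using prime_gt_1_nat[OF p] by (simp add: power_gt_expt)
      also have "p ^ j \<le> n" using n' by simp
      finally have "j \<le> M" using n by simp
      moreover have "m \<le> n" using n' prime_gt_0_nat[OF p] by simp
      hence "m \<le> M" using n by simp
      moreover have "prime_factors m \<subseteq> F"
      proof
        fix q assume q: "q \<in> prime_factors m"
        hence "q \<in> prime_factors n" using n n' by (auto simp: prime_factors_dvd)
        moreover have "q \<noteq> p" using q n' by (auto simp: prime_factors_dvd)
        ultimately show "q \<in> F" using n by blast
      qed
      ultimately show "n \<in> (\<lambda>(j, m). p ^ j * m) ` ({..M} \<times> ?B)"
        using n n' by (intro image_eqI[of _ _ "(j, m)"]) auto
    qed
    show "0 \<le> ?f b" if "b \<in> (\<lambda>(j, m). p ^ j * m) ` ({..M} \<times> ?B) - ?A" for b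
    proof -
      have "b > 0" using that prime_gt_0_nat[OF p] by auto
      thus ?thesis using r_nonneg by simp
    qed
  qed (use finB in auto)
  also have "\<dots> \<le> sum (?f \<circ> (\<lambda>(j, m). p ^ j * m)) ({..M} \<times> ?B)"
  proof (rule sum_image_le)
    show "0 \<le> ?f (case x of (j, m) \<Rightarrow> p ^ j * m)" if "x \<in> {..M} \<times> ?B" for x
    proof -
      have "(case x of (j, m) \<Rightarrow> p ^ j * m) > 0" using that prime_gt_0_nat[OF p] by auto
      thus ?thesis using r_nonneg by simp
    qed
  qed (use finB in auto)
  also have "\<dots> = (\<Sum>(j, m)\<in>{..M} \<times> ?B. r (p ^ j) / real p ^ j * (r m / real m))"
  proof (rule sum.cong, simp, clarify)
    fix j m assume m: "0 < m" "m \<le> M" "prime_factors m \<subseteq> F"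
    have "\<not> p dvd m" using m p F(2) by (auto simp: prime_factors_dvd)
    hence "coprime (p ^ j) m" using p by (simp add: prime_imp_coprime)
    thus "(?f \<circ> (\<lambda>(j, m). p ^ j * m)) (j, m) = r (p ^ j) / real p ^ j * (r m / real m)"
      by (simp add: r_mult_coprime)
  qed
  also have "\<dots> = ?e * sum ?f ?B" by (simp add: sum_product sum.cartesian_product)
  finally show ?thesis .
qed

lemma sum_r_div_le_prod:
  assumes "finite F" "\<And>q. q \<in> F \<Longrightarrow> prime q" "M > 0"
  shows "(\<Sum>n | 0 < n \<and> n \<le> M \<and> prime_factors n \<subseteq> F. r n / real n) \<le>
     (\<Prod>p\<in>F. \<Sum>j\<le>M. r (p ^ j) / real p ^ j)"
  using assms(1,2)
proof (induction F rule: finite_induct)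
  case empty
  have "{n. 0 < n \<and> n \<le> M \<and> prime_factors n \<subseteq> {}} = {1}"
    using assms(3) by (auto simp: prime_factorization_empty_iff)
  thus ?case using r_one by simp
next
  case (insert p F)
  have "(\<Sum>n | 0 < n \<and> n \<le> M \<and> prime_factors n \<subseteq> insert p F. r n / real n) \<le>
     (\<Sum>j\<le>M. r (p ^ j) / real p ^ j) * (\<Sum>n | 0 < n \<and> n \<le> M \<and> prime_factors n \<subseteq> F. r n / real n)"
    using insert by (intro sum_r_div_insert_prime_le) auto
  also have "\<dots> \<le> (\<Sum>j\<le>M. r (p ^ j) / real p ^ j) * (\<Prod>p\<in>F. \<Sum>j\<le>M. r (p ^ j) / real p ^ j)"
    using insert r_prime_power_bounds(1)[of p] by (intro mult_left_mono sum_nonneg) auto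
  also have "\<dots> = (\<Prod>p\<in>insert p F. \<Sum>j\<le>M. r (p ^ j) / real p ^ j)"
    using insert by simp
  finally show ?case .
qed

text \<open>Where \<open>c p = -1\<close>, only even exponents survive and no term
  \<open>1 / p\<close> occurs. Otherwise \<open>r (p ^ j) \<le> j + 1\<close> bounds the factor by
  \<open>(1 - 1/p)^(-2)\<close>.\<close>

lemma euler_factor_le:
  assumes "prime p"
  shows "(\<Sum>j\<le>M. r (p ^ j) / real p ^ j) \<le>
    exp ((if c p = -1 then 0 else 2 / real p) + 2 / real p ^ 2)"
proof -
  define t where "t = 1 / real p"
  have p2: "real p \<ge> 2" using prime_ge_2_nat[OF assms] by simp
  have t: "0 \<le> t" "t \<le> 1/2" "t < 1" using p2 by (auto simp: t_def field_simps)
  have eq: "r (p ^ j) / real p ^ j = r (p ^ j) * t ^ j" for j by (simp add: t_def power_divide)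
  show ?thesis
  proof (cases "c p = -1")
    case True
    have "r (p ^ j) / real p ^ j = (if even j then 1 else 0) * t ^ j" for j
      using eq[of j] r_prime_power_cases(3)[OF assms True, of j] by simp
    hence "(\<Sum>j\<le>M. r (p ^ j) / real p ^ j) \<le> 1 / (1 - t\<^sup>2)"
      using sum_even_power_le[OF t(1,3), of M] by (simp only:)
    also have "\<dots> \<le> exp (t\<^sup>2 + (t\<^sup>2)\<^sup>2)"
    proof (rule inverse_one_minus_le_exp)
      have "t\<^sup>2 \<le> (1/2)\<^sup>2" using t by (intro power_mono) auto
      thus "t\<^sup>2 \<le> 1/2" by (simp add: power2_eq_square)
    qed simp
    also have "(t\<^sup>2)\<^sup>2 \<le> t\<^sup>2"
      using t by (simp add: power2_eq_square mult_le_one mult_left_le)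
    hence "exp (t\<^sup>2 + (t\<^sup>2)\<^sup>2) \<le> exp (2 * t\<^sup>2)" by simp
    finally show ?thesis using True by (simp add: t_def power_divide)
  next
    case False
    have "(\<Sum>j\<le>M. r (p ^ j) / real p ^ j) \<le> (\<Sum>j\<le>M. (real j + 1) * t ^ j)"
      unfolding eq using t r_prime_power_bounds(2)[OF assms] by (intro sum_mono mult_right_mono) auto
    also have "\<dots> \<le> (1 / (1 - t))\<^sup>2" using sum_mult_power_le[OF t(1,3), of M] by (simp add: power_divide)
    also have "\<dots> \<le> (exp (t + t\<^sup>2))\<^sup>2"
      using t by (intro power_mono inverse_one_minus_le_exp) auto
    also have "\<dots> = exp (2 * t + 2 * t\<^sup>2)" by (simp add: exp_double[symmetric] distrib_left)
    finally show ?thesis using False by (simp add: t_def power_divide)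
  qed
qed

definition S :: "nat \<Rightarrow> real" where
  "S x = (\<Sum>n=1..x. r n / real n)"

text \<open>Only primes with \<open>c p \<noteq> -1\<close> enter to first order; the squares of all
  primes together add at most 2 to the exponent.\<close>

lemma S_le_exp_prime_sum:
  assumes "Q > 0"
  shows "S Q \<le> exp (2 * (\<Sum>p | prime p \<and> p \<le> Q \<and> c p \<noteq> -1. 1 / real p) + 2)"
proof -
  define F where "F = {p. prime p \<and> p \<le> Q}"
  have finF: "finite F" by (simp add: F_def)
  have pF: "prime p" if "p \<in> F" for p using that by (simp add: F_def)
  have "p \<le> Q" if "p dvd n" "0 < n" "n \<le> Q" for p n using dvd_imp_le[OF that(1,2)] that(3) by simp
  hence "{n. 0 < n \<and> n \<le> Q \<and> prime_factors n \<subseteq> F} = {1..Q}"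
    by (auto simp: F_def prime_factors_dvd)
  hence "S Q \<le> (\<Prod>p\<in>F. \<Sum>j\<le>Q. r (p ^ j) / real p ^ j)"
    using sum_r_div_le_prod[OF finF pF assms] by (simp add: S_def)
  also have "\<dots> \<le> (\<Prod>p\<in>F. exp ((if c p = -1 then 0 else 2 / real p) + 2 / real p ^ 2))"
    using pF by (intro prod_mono conjI euler_factor_le sum_nonneg)
      (auto intro!: divide_nonneg_nonneg r_prime_power_bounds(1))
  also have "\<dots> = exp ((\<Sum>p\<in>F. if c p = -1 then 0 else 2 / real p) + 2 * (\<Sum>p\<in>F. 1 / real p ^ 2))"
    using finF by (simp add: exp_sum[symmetric] sum.distrib sum_distrib_left)
  also have "\<dots> \<le> exp ((\<Sum>p\<in>F. if c p = -1 then 0 else 2 / real p) + 2)"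
    using sum_inverse_squares_le[OF finF] pF prime_ge_2_nat by simp
  also have "(\<Sum>p\<in>F. if c p = -1 then 0 else 2 / real p) =
      2 * (\<Sum>p | prime p \<and> p \<le> Q \<and> c p \<noteq> -1. 1 / real p)"
  proof -
    have "(\<Sum>p\<in>F. if c p = -1 then 0 else 2 / real p) = (\<Sum>p\<in>F. if c p \<noteq> -1 then 2 / real p else 0)"
      by (rule sum.cong) auto
    also have "\<dots> = (\<Sum>p\<in>{p\<in>F. c p \<noteq> -1}. 2 / real p)"
      by (rule sum.inter_filter[symmetric, OF finF])
    also have "{p\<in>F. c p \<noteq> -1} = {p. prime p \<and> p \<le> Q \<and> c p \<noteq> -1}" by (auto simp: F_def)
    finally show ?thesis by (simp add: sum_distrib_left)
  qed
  finally show ?thesis .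
qed

end

section \<open>Multiplying by primes at which the character is nonnegative\<close>

text \<open>The product of these prime divisors divides \<open>n\<close> and is at least
  \<open>w\<close> to the power of their number.\<close>

lemma card_primes_dvd_mult_ln_le:
  assumes "finite P" "\<And>p. p \<in> P \<Longrightarrow> prime p \<and> w \<le> real p" "w > 1" "n > 0"
  shows "real (card {p\<in>P. p dvd n}) * ln w \<le> ln (real n)"
proof -
  define A where "A = {p\<in>P. p dvd n}"
  have fin: "finite A" using assms(1) by (simp add: A_def)
  have "\<Prod>A dvd n" using assms(2) fin by (intro prod_primes_dvd) (auto simp: A_def)
  hence le: "\<Prod>A \<le> n" using assms(4) by (intro dvd_imp_le)
  have "w ^ card A = (\<Prod>p\<in>A. w)" by simp
  also have "\<dots> \<le> (\<Prod>p\<in>A. real p)" using assms(2,3) by (intro prod_mono) (auto simp: A_def)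
  also have "\<dots> \<le> real n" using of_nat_mono[OF le, where 'a = real] by simp
  finally have "ln (w ^ card A) \<le> ln (real n)" using assms(3,4) by simp
  thus ?thesis using assms(3) by (simp add: A_def ln_realpow)
qed

context real_character
begin

context
  fixes P :: "nat set" and Q :: nat
begin

text \<open>Products of some \<open>n \<le> Q\<close> with \<open>j\<close> primes from
  \<open>P\<close>, repetitions allowed. A set forgets how often a product arises;
  \<open>sum_prime_multiples_step\<close> pays for that.\<close>

fun prime_multiples :: "nat \<Rightarrow> nat set" where
  "prime_multiples 0 = {1..Q}"
| "prime_multiples (Suc j) = (\<lambda>(n, p). n * p) ` (prime_multiples j \<times> P)"

lemma finite_prime_multiples: "finite P \<Longrightarrow> finite (prime_multiples j)"
  by (induction j) auto

text \<open>The strict lower bound for \<open>j > 0\<close> places all products beyond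
  \<open>Q\<close> once \<open>Q \<le> w ^ j\<close>.\<close>

lemma prime_multiples_bounds:
  assumes "\<And>p. p \<in> P \<Longrightarrow> prime p \<and> w < real p \<and> p \<le> Q" "w > 1"
  shows "n \<in> prime_multiples j \<Longrightarrow>
    n > 0 \<and> n \<le> Q ^ (j + 1) \<and> w ^ j \<le> real n \<and> (j > 0 \<longrightarrow> w ^ j < real n)"
proof (induction j arbitrary: n)
  case (Suc j)
  then obtain m p where n: "n = m * p" and m: "m \<in> prime_multiples j" and p: "p \<in> P" by auto
  from Suc.IH[OF m] have IH: "m > 0" "m \<le> Q ^ (j + 1)" "w ^ j \<le> real m" by auto
  from assms(1)[OF p] have p': "prime p" "w < real p" "p \<le> Q" by auto
  have "w ^ Suc j = w ^ j * w" by simp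
  also have "\<dots> < w ^ j * real p" using p'(2) assms(2) by (intro mult_strict_left_mono) auto
  also have "\<dots> \<le> real m * real p" using IH(3) by (intro mult_right_mono) auto
  finally have "w ^ Suc j < real n" by (simp add: n)
  moreover have "n \<le> Q ^ (j + 1) * Q" unfolding n using IH p' by (intro mult_le_mono)
  moreover have "n > 0" using n IH p' prime_gt_0_nat by simp
  ultimately show ?case by (simp add: mult.commute)
qed auto

text \<open>Multiplication by a prime of \<open>P\<close> does not decrease \<open>r\<close>, and a
  product is reached at most once for each \<open>p\<close> in \<open>P\<close> dividing it. The
  size bounds allow at most \<open>k * (j + 2)\<close> such primes.\<close>

lemma sum_prime_multiples_step:
  assumes P: "finite P" "\<And>p. p \<in> P \<Longrightarrow> prime p \<and> w < real p \<and> p \<le> Q \<and> c p \<ge> 0" "w > 1"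
    and Q: "real Q \<le> w ^ k" and j: "j < k"
  shows "(\<Sum>p\<in>P. 1 / real p) * (\<Sum>n\<in>prime_multiples j. r n / real n) \<le>
    real (k + 1) ^ 2 * (\<Sum>n\<in>prime_multiples (Suc j). r n / real n)"
proof -
  let ?N = "prime_multiples j" and ?N' = "prime_multiples (Suc j)"
  note bds = prime_multiples_bounds[of w, OF _ P(3)]
  have fin: "finite ?N" "finite ?N'" using P(1) finite_prime_multiples by blast+
  have card_le: "real (card {p\<in>P. p dvd n}) \<le> real (k + 1) ^ 2" if n: "n \<in> ?N'" for n
  proof -
    have b: "n > 0" "n \<le> Q ^ (j + 2)" using bds[OF _ n] P(2) by auto
    have "Q > 0" using b by (intro gr0I) auto
    have "real n \<le> real Q ^ (j + 2)" using b(2) by (metis of_nat_le_iff of_nat_power)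
    also have "\<dots> \<le> (w ^ k) ^ (j + 2)" using Q by (intro power_mono) auto
    also have "\<dots> = w ^ (k * (j + 2))" by (rule power_mult[symmetric])
    finally have "ln (real n) \<le> real (k * (j + 2)) * ln w"
      using b P(3) by (metis ln_le_cancel_iff ln_realpow of_nat_0_less_iff order_less_trans zero_less_one zero_less_power)
    moreover have "real (card {p\<in>P. p dvd n}) * ln w \<le> ln (real n)"
      using P b by (intro card_primes_dvd_mult_ln_le) (auto intro: less_imp_le)
    ultimately have "real (card {p\<in>P. p dvd n}) * ln w \<le> real (k * (j + 2)) * ln w" by linarith
    hence "card {p\<in>P. p dvd n} \<le> k * (j + 2)" using P(3) by (simp del: of_nat_mult)
    also have "\<dots> \<le> (k + 1) * (k + 1)" using j by (intro mult_le_mono) auto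
    finally have "real (card {p\<in>P. p dvd n}) \<le> real ((k + 1) * (k + 1))" by (simp only: of_nat_le_iff)
    thus ?thesis by (simp only: power2_eq_square of_nat_mult)
  qed
  have "(\<Sum>p\<in>P. 1 / real p) * (\<Sum>n\<in>?N. r n / real n) = (\<Sum>(p, n)\<in>P \<times> ?N. r n / real (n * p))"
    by (simp add: sum_product sum.cartesian_product mult.commute)
  also have "\<dots> \<le> (\<Sum>(p, n)\<in>P \<times> ?N. r (n * p) / real (n * p))"
    using P bds by (intro sum_mono) (auto intro!: divide_right_mono r_mult_prime_ge)
  \<comment> \<open>Keeping \<open>p\<close> next to the product makes the map injective; the
    overcount of a product is then the number of its divisors in \<open>P\<close>.\<close>
  also have "\<dots> = (\<Sum>(p, n')\<in>(\<lambda>(p, n). (p, n * p)) ` (P \<times> ?N). r n' / real n')"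
  proof (subst sum.reindex)
    show "inj_on (\<lambda>(p, n). (p, n * p)) (P \<times> ?N)"
      using P(2) prime_gt_0_nat by (fastforce simp: inj_on_def)
  qed (auto simp: case_prod_unfold)
  also have "\<dots> \<le> (\<Sum>(p, n')\<in>(SIGMA p:P. {n'\<in>?N'. p dvd n'}). r n' / real n')"
  proof (rule sum_mono2)
    show "finite (SIGMA p:P. {n'\<in>?N'. p dvd n'})" using P(1) fin by auto
    show "(\<lambda>(p, n). (p, n * p)) ` (P \<times> ?N) \<subseteq> (SIGMA p:P. {n'\<in>?N'. p dvd n'})" by auto
    fix x assume "x \<in> (SIGMA p:P. {n'\<in>?N'. p dvd n'}) - (\<lambda>(p, n). (p, n * p)) ` (P \<times> ?N)"
    hence x: "snd x \<in> ?N'" by auto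
    have "snd x > 0" using bds[OF _ x] P(2) by auto
    thus "0 \<le> (case x of (p, n') \<Rightarrow> r n' / real n')" using r_nonneg by (simp add: case_prod_unfold)
  qed
  also have "\<dots> = (\<Sum>p\<in>P. \<Sum>n' | n' \<in> ?N' \<and> p dvd n'. r n' / real n')"
    using P(1) fin by (subst sum.Sigma) auto
  also have "\<dots> = (\<Sum>n'\<in>?N'. \<Sum>p | p \<in> P \<and> p dvd n'. r n' / real n')"
    by (rule sum.swap_restrict[OF P(1) fin(2)])
  also have "\<dots> = (\<Sum>n'\<in>?N'. real (card {p\<in>P. p dvd n'}) * (r n' / real n'))" by simp
  also have "\<dots> \<le> (\<Sum>n'\<in>?N'. real (k + 1) ^ 2 * (r n' / real n'))"
  proof (rule sum_mono)
    fix n assume n: "n \<in> ?N'"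
    have "n > 0" using bds[OF _ n] P(2) by auto
    thus "real (card {p\<in>P. p dvd n}) * (r n / real n) \<le> real (k + 1) ^ 2 * (r n / real n)"
      using card_le[OF n] r_nonneg by (intro mult_right_mono) auto
  qed
  finally show ?thesis by (simp only: sum_distrib_left)
qed

end

text \<open>Iterating the step \<open>k\<close> times carries the mass \<open>S Q\<close> to
  products in \<open>(Q, Q ^ (k + 1)]\<close>, each time with the factor called \<open>W\<close>
  below.\<close>

lemma S_growth:
  assumes P: "finite P" "\<And>p. p \<in> P \<Longrightarrow> prime p \<and> w < real p \<and> p \<le> Q \<and> c p \<ge> 0" "w > 1"
    and Q: "real Q \<le> w ^ k" and k: "k > 0"
  shows "((\<Sum>p\<in>P. 1 / real p) / real (k + 1) ^ 2) ^ k * S Q \<le> S (Q ^ (k + 1)) - S Q"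
proof -
  define W where "W = (\<Sum>p\<in>P. 1 / real p) / real (k + 1) ^ 2"
  define a where "a j = (\<Sum>n\<in>prime_multiples P Q j. r n / real n)" for j
  have W0: "W \<ge> 0" unfolding W_def by (intro divide_nonneg_nonneg sum_nonneg) auto
  have "W ^ j * S Q \<le> a j" if "j \<le> k" for j
    using that
  proof (induction j)
    case 0
    show ?case by (simp add: a_def S_def)
  next
    case (Suc j)
    have "W ^ Suc j * S Q = W * (W ^ j * S Q)" by simp
    also have "\<dots> \<le> W * a j" using Suc W0 by (intro mult_left_mono) auto
    also have "\<dots> \<le> a (Suc j)"
      using sum_prime_multiples_step[OF P Q, of j] Suc.prems
      by (simp add: a_def W_def field_simps del: prime_multiples.simps)
    finally show ?case .
  qed
  hence "W ^ k * S Q \<le> a k" by simp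
  also have "a k \<le> (\<Sum>n\<in>{Q<..Q ^ (k + 1)}. r n / real n)"
    unfolding a_def
  proof (rule sum_mono2)
    show "prime_multiples P Q k \<subseteq> {Q<..Q ^ (k + 1)}"
    proof
      fix n assume n: "n \<in> prime_multiples P Q k"
      have "n \<le> Q ^ (k + 1) \<and> w ^ k < real n"
        using prime_multiples_bounds[OF _ P(3) n] P(2) k by auto
      thus "n \<in> {Q<..Q ^ (k + 1)}" using Q by auto
    qed
  qed (auto intro!: divide_nonneg_nonneg r_nonneg)
  also have "\<dots> = S (Q ^ (k + 1)) - S Q"
  proof (cases "Q = 0")
    case False
    define X where "X = Q ^ (k + 1)"
    have "Q \<le> X" using False by (simp add: X_def)
    thus ?thesis unfolding S_def X_def[symmetric] by (simp only: sum_split_greaterThanAtMost)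
  qed (simp add: S_def)
  finally show ?thesis unfolding W_def .
qed

end

section \<open>Power sums\<close>

text \<open>Mean value theorem for \<open>t powr \<delta> / \<delta>\<close>.\<close>

lemma powr_diff_div_bounds:
  fixes a b \<delta> :: real
  assumes "0 < a" "a \<le> b" "0 < \<delta>" "\<delta> < 1"
  shows "(b - a) * b powr (\<delta> - 1) \<le> (b powr \<delta> - a powr \<delta>) / \<delta>"
    and "(b powr \<delta> - a powr \<delta>) / \<delta> \<le> (b - a) * a powr (\<delta> - 1)"
proof -
  have "(b - a) * b powr (\<delta> - 1) \<le> (b powr \<delta> - a powr \<delta>) / \<delta> \<and>
    (b powr \<delta> - a powr \<delta>) / \<delta> \<le> (b - a) * a powr (\<delta> - 1)"
  proof (cases "a = b")
    case False
    hence ab: "a < b" using assms by simp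
    have "\<exists>z>a. z < b \<and> b powr \<delta> / \<delta> - a powr \<delta> / \<delta> = (b - a) * z powr (\<delta> - 1)"
    proof (rule MVT2[OF ab])
      fix x assume "a \<le> x" "x \<le> b"
      thus "((\<lambda>t. t powr \<delta> / \<delta>) has_real_derivative x powr (\<delta> - 1)) (at x)"
        by (intro DERIV_cong[OF DERIV_cdivide[OF has_real_derivative_powr]])
          (use assms in simp_all)
    qed
    then obtain z where z: "a < z" "z < b" "(b powr \<delta> - a powr \<delta>) / \<delta> = (b - a) * z powr (\<delta> - 1)"
      by (auto simp: diff_divide_distrib)
    have "b powr (\<delta> - 1) \<le> z powr (\<delta> - 1)" "z powr (\<delta> - 1) \<le> a powr (\<delta> - 1)"
      using z assms by (auto intro!: powr_mono2')
    thus ?thesis unfolding z(3) using ab by (auto intro!: mult_left_mono)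
  qed simp
  thus "(b - a) * b powr (\<delta> - 1) \<le> (b powr \<delta> - a powr \<delta>) / \<delta>"
    and "(b powr \<delta> - a powr \<delta>) / \<delta> \<le> (b - a) * a powr (\<delta> - 1)" by auto
qed

text \<open>This is \<open>1 - y \<le> exp (- y)\<close> at \<open>y = \<delta> * ln t\<close>. The
  bound stays finite as \<open>\<delta>\<close> tends to 0.\<close>

lemma powr_minus_one_div_le_ln:
  fixes t \<delta> :: real
  assumes "t > 0" "0 < \<delta>"
  shows "(t powr \<delta> - 1) / \<delta> \<le> ln t * t powr \<delta>"
proof -
  have "1 - \<delta> * ln t \<le> exp (- (\<delta> * ln t))" using exp_ge_add_one_self[of "- (\<delta> * ln t)"] by simp
  hence "(1 - \<delta> * ln t) * exp (\<delta> * ln t) \<le> exp (- (\<delta> * ln t)) * exp (\<delta> * ln t)"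
    by (intro mult_right_mono) auto
  also have "\<dots> = 1" by (simp add: exp_add[symmetric])
  finally have "t powr \<delta> - 1 \<le> \<delta> * (ln t * t powr \<delta>)"
    using assms by (simp add: powr_def algebra_simps)
  thus ?thesis using assms by (simp add: field_simps)
qed

text \<open>The upper bound is free of \<open>\<delta>\<close>: \<open>ln t\<close> and
  \<open>t powr \<delta>\<close> each cost one power \<open>t powr (1/8)\<close>, the former with
  the constant 8.\<close>

lemma powr_minus_one_div_le:
  fixes t \<delta> :: real
  assumes "t \<ge> 1" "0 < \<delta>" "\<delta> \<le> 1/8"
  shows "0 \<le> (t powr \<delta> - 1) / \<delta>" "(t powr \<delta> - 1) / \<delta> \<le> 8 * t powr (1/4)"
proof -
  have "1 \<le> t powr \<delta>" using assms by (intro ge_one_powr_ge_zero) auto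
  thus "0 \<le> (t powr \<delta> - 1) / \<delta>" using assms by simp
  have "(t powr \<delta> - 1) / \<delta> \<le> ln t * t powr \<delta>" using assms by (intro powr_minus_one_div_le_ln) auto
  also have "\<dots> \<le> (t powr (1/8) / (1/8)) * t powr (1/8)"
    using assms by (intro mult_mono ln_powr_bound powr_mono) auto
  also have "\<dots> = 8 * t powr (1/4)" using assms by (simp add: powr_add[symmetric])
  finally show "(t powr \<delta> - 1) / \<delta> \<le> 8 * t powr (1/4)" .
qed

lemma powr_diff_div_abs_le:
  fixes t x \<delta> :: real
  assumes "t \<ge> 1" "x \<ge> 1" "0 < \<delta>" "\<delta> \<le> 1/8"
  shows "\<bar>(t powr \<delta> - x powr \<delta>) / \<delta>\<bar> \<le> 8 * (x powr (1/4) * t powr (1/4))"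
proof -
  note t = powr_minus_one_div_le[OF assms(1,3,4)] and x = powr_minus_one_div_le[OF assms(2,3,4)]
  have 1: "1 \<le> t powr (1/4)" "1 \<le> x powr (1/4)" using assms by (auto intro!: ge_one_powr_ge_zero)
  have "t powr (1/4) \<le> x powr (1/4) * t powr (1/4)" "x powr (1/4) \<le> x powr (1/4) * t powr (1/4)"
    using 1 mult_right_mono[of 1 "x powr (1/4)" "t powr (1/4)"] mult_left_mono[of 1 "t powr (1/4)" "x powr (1/4)"]
    by auto
  moreover have "(t powr \<delta> - x powr \<delta>) / \<delta> = (t powr \<delta> - 1) / \<delta> - (x powr \<delta> - 1) / \<delta>"
    by (simp add: diff_divide_distrib)
  ultimately show ?thesis using t x by linarith
qed

text \<open>The constant \<open>\<gamma>\<close> is in classical terms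
  \<open>zeta(1 - \<delta>) + 1 / \<delta>\<close>. Using
  \<open>(z powr \<delta> - 1) / \<delta>\<close> as main term keeps it in \<open>[0, 1]\<close>,
  whereas \<open>zeta(1 - \<delta>)\<close> alone is unbounded as \<open>\<delta>\<close> tends to
  0.\<close>

lemma sum_powr_asymptotics:
  fixes \<delta> :: real
  assumes "0 < \<delta>" "\<delta> < 1"
  obtains \<gamma> where "0 \<le> \<gamma>" "\<gamma> \<le> 1"
    "\<And>z. z \<ge> 1 \<Longrightarrow> \<bar>(\<Sum>a=1..nat \<lfloor>z\<rfloor>. real a powr (\<delta> - 1)) - ((z powr \<delta> - 1) / \<delta> + \<gamma>)\<bar> \<le> 2 * z powr (\<delta> - 1)"
proof -
  \<comment> \<open>The sequence \<open>u\<close> decreases, while \<open>v\<close>, smaller by the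
    last summand, increases; they enclose \<open>\<gamma>\<close>.\<close>
  define u where "u m = (\<Sum>a=1..Suc m. real a powr (\<delta> - 1)) - (real (Suc m) powr \<delta> - 1) / \<delta>" for m
  define v where "v m = u m - real (Suc m) powr (\<delta> - 1)" for m
  have u_step: "u (Suc m) = u m + real (Suc (Suc m)) powr (\<delta> - 1)
      - (real (Suc (Suc m)) powr \<delta> - real (Suc m) powr \<delta>) / \<delta>" for m
    by (simp add: u_def diff_divide_distrib)
  have dec: "decseq u"
  proof (rule decseq_SucI)
    fix m
    show "u (Suc m) \<le> u m"
      using powr_diff_div_bounds(1)[OF _ _ assms, of "real (Suc m)" "real (Suc (Suc m))"] u_step[of m] by simp
  qed
  have inc: "incseq v"
  proof (rule incseq_SucI)
    fix m
    show "v m \<le> v (Suc m)"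
      using powr_diff_div_bounds(2)[OF _ _ assms, of "real (Suc m)" "real (Suc (Suc m))"] u_step[of m]
      by (simp add: v_def)
  qed
  have v0: "v 0 = 0" "u 0 = 1" by (auto simp: v_def u_def)
  have vu: "v m \<le> u m" for m by (simp add: v_def)
  have "0 \<le> u m" for m using incseqD[OF inc, of 0 m] v0 vu[of m] by simp
  then obtain \<gamma> where \<gamma>: "u \<longlonglongrightarrow> \<gamma>" "\<And>i. \<gamma> \<le> u i" using decseq_convergent[OF dec] by metis
  have v\<gamma>: "v m \<le> \<gamma>" for m
  proof (rule LIMSEQ_le_const[OF \<gamma>(1)], intro exI allI impI)
    fix n assume "m \<le> n"
    thus "v m \<le> u n" using incseqD[OF inc, of m n] vu[of n] by simp
  qed
  show ?thesis
  proof (rule that)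
    show "0 \<le> \<gamma>" using v\<gamma>[of 0] v0 by simp
    show "\<gamma> \<le> 1" using \<gamma>(2)[of 0] v0 by simp
    fix z :: real assume z: "z \<ge> 1"
    define m where "m = nat \<lfloor>z\<rfloor> - 1"
    have m: "nat \<lfloor>z\<rfloor> = Suc m" using z by (simp add: m_def le_floor_iff)
    have mz: "real (Suc m) \<le> z" "z < real (Suc m) + 1"
      unfolding m[symmetric] using z by auto
    have "(z powr \<delta> - real (Suc m) powr \<delta>) / \<delta> \<le> (z - real (Suc m)) * real (Suc m) powr (\<delta> - 1)"
      using mz by (intro powr_diff_div_bounds assms) auto
    also have "\<dots> \<le> 1 * real (Suc m) powr (\<delta> - 1)" using mz by (intro mult_right_mono) auto
    finally have 1: "(z powr \<delta> - real (Suc m) powr \<delta>) / \<delta> \<le> real (Suc m) powr (\<delta> - 1)" by simp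
    have 2: "(z powr \<delta> - real (Suc m) powr \<delta>) / \<delta> \<ge> 0"
      using mz assms by (auto intro!: divide_nonneg_nonneg powr_mono2)
    \<comment> \<open>Here \<open>Suc m\<close> is the integer part of \<open>z\<close>, hence at
      least \<open>z / 2\<close>; this causes the factor 2 in the error.\<close>
    have "real (Suc m) powr (\<delta> - 1) \<le> (z / 2) powr (\<delta> - 1)"
      using mz z assms by (intro powr_mono2') auto
    also have "\<dots> = z powr (\<delta> - 1) * 2 powr (1 - \<delta>)"
      using z by (simp add: powr_divide powr_diff powr_minus field_simps)
    also have "\<dots> \<le> z powr (\<delta> - 1) * 2 powr 1"
      using assms by (intro mult_left_mono powr_mono) auto
    finally have 3: "real (Suc m) powr (\<delta> - 1) \<le> 2 * z powr (\<delta> - 1)" by simp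
    have "(\<Sum>a=1..nat \<lfloor>z\<rfloor>. real a powr (\<delta> - 1)) - ((z powr \<delta> - 1) / \<delta> + \<gamma>) =
        (u m - \<gamma>) - (z powr \<delta> - real (Suc m) powr \<delta>) / \<delta>"
      unfolding m u_def by (simp add: diff_divide_distrib)
    moreover have "0 \<le> u m - \<gamma>" "u m - \<gamma> \<le> real (Suc m) powr (\<delta> - 1)"
      using \<gamma>(2)[of m] v\<gamma>[of m] by (auto simp: v_def)
    ultimately show "\<bar>(\<Sum>a=1..nat \<lfloor>z\<rfloor>. real a powr (\<delta> - 1)) - ((z powr \<delta> - 1) / \<delta> + \<gamma>)\<bar> \<le> 2 * z powr (\<delta> - 1)"
      using 1 2 3 by linarith
  qed
qed

text \<open>
  The kernel \<open>g\<close> is the main term of \<open>b^(\<delta> - 1) * (\<Sum>a\<le>x/b. a^(\<delta> - 1))\<close> at \<open>b = t\<close>. Its two summands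
  of size \<open>1/\<delta>\<close> must be kept together, as \<open>\<delta>\<close> may be arbitrarily small.
\<close>

lemma kernel_bounds:
  fixes x \<delta> \<gamma> :: real
  assumes x: "x \<ge> 1" and \<delta>: "0 < \<delta>" "\<delta> \<le> 1/8" and \<gamma>: "0 \<le> \<gamma>" "\<gamma> \<le> 1"
  defines "g \<equiv> \<lambda>t. (x powr \<delta> / t - t powr (\<delta> - 1)) / \<delta> + \<gamma> * t powr (\<delta> - 1)"
    and "G \<equiv> \<lambda>t. 14 * x powr (1/4) * t powr (-3/4)"
  shows "t \<ge> 1 \<Longrightarrow> \<bar>g t\<bar> \<le> G t"
    and "1 \<le> a \<Longrightarrow> a \<le> b \<Longrightarrow> \<bar>g a - g b\<bar> \<le> G a - G b"
proof -
  have x4: "x powr (1/4) \<ge> 1" using x by (intro ge_one_powr_ge_zero) auto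
  {
    fix t :: real assume t: "t \<ge> 1"
    have "g t = - ((t powr \<delta> - x powr \<delta>) / \<delta>) / t + \<gamma> * t powr (\<delta> - 1)"
      using t \<delta> by (simp add: g_def powr_diff field_simps)
    hence "\<bar>g t\<bar> \<le> \<bar>- ((t powr \<delta> - x powr \<delta>) / \<delta>) / t\<bar> + \<bar>\<gamma> * t powr (\<delta> - 1)\<bar>"
      by (metis abs_triangle_ineq)
    also have "\<bar>- ((t powr \<delta> - x powr \<delta>) / \<delta>) / t\<bar> = \<bar>(t powr \<delta> - x powr \<delta>) / \<delta>\<bar> / t"
      using t by (simp only: abs_divide abs_minus abs_of_pos[of t])
    also have "\<dots> \<le> 8 * (x powr (1/4) * t powr (1/4)) / t"
      using t by (intro divide_right_mono powr_diff_div_abs_le x \<delta>) auto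
    also have "\<dots> = 8 * (x powr (1/4) * (t powr (1/4) / t))" by simp
    also have "t powr (1/4) / t = t powr (-3/4)" using t powr_diff[of t "1/4" 1] by simp
    also have "\<bar>\<gamma> * t powr (\<delta> - 1)\<bar> \<le> 1 * t powr (-3/4)"
      unfolding abs_mult using \<gamma> \<delta> t by (intro mult_mono) (auto intro!: powr_mono)
    also have "1 * t powr (-3/4) \<le> x powr (1/4) * t powr (-3/4)"
      using x4 by (intro mult_right_mono) auto
    finally have "\<bar>g t\<bar> \<le> 9 * (x powr (1/4) * t powr (-3/4))" by simp
    also have "\<dots> \<le> G t" by (simp add: G_def)
    finally show "\<bar>g t\<bar> \<le> G t" .
  }
  define g' where "g' t = (- (x powr \<delta>) / t\<^sup>2 - (\<delta> - 1) * t powr (\<delta> - 2)) / \<delta> + \<gamma> * ((\<delta> - 1) * t powr (\<delta> - 2))" for t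
  \<comment> \<open>The constant 14 gives \<open>- G'\<close> the coefficient 21/2, above the 10 = 8
    + 2 needed for \<open>g'\<close>.\<close>
  define G' where "G' t = 14 * x powr (1/4) * ((-3/4) * t powr (-7/4))" for t
  have g': "(g has_real_derivative g' t) (at t)" if "t \<ge> 1" for t
  proof -
    have p: "((\<lambda>t. t powr (\<delta> - 1)) has_real_derivative (\<delta> - 1) * t powr (\<delta> - 2)) (at t)"
      by (rule DERIV_cong[OF has_real_derivative_powr]) (use that in simp_all)
    have q: "((\<lambda>t. x powr \<delta> / t) has_real_derivative - (x powr \<delta>) / t\<^sup>2) (at t)"
      using that by (auto intro!: derivative_eq_intros simp: power2_eq_square)
    show ?thesis unfolding g_def g'_def
      by (intro DERIV_add DERIV_cdivide DERIV_diff DERIV_cmult p q)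
  qed
  have G': "(G has_real_derivative G' t) (at t)" if "t \<ge> 1" for t
    unfolding G_def G'_def
    by (intro DERIV_cmult DERIV_cong[OF has_real_derivative_powr]) (use that in simp_all)
  have bd: "\<bar>g' t\<bar> \<le> - G' t" if t: "t \<ge> 1" for t
  proof -
    have "t powr (\<delta> - 2) = t powr \<delta> / t\<^sup>2" using t by (simp add: powr_diff powr_numeral)
    \<comment> \<open>Collecting the two parts of size \<open>1 / \<delta>\<close> restores the
      quotient bounded by \<open>powr_diff_div_abs_le\<close>.\<close>
    hence "g' t = ((t powr \<delta> - x powr \<delta>) / \<delta>) / t\<^sup>2 - (1 + \<gamma> * (1 - \<delta>)) * t powr (\<delta> - 2)"
      using \<delta> t by (simp add: g'_def field_simps)
    hence "\<bar>g' t\<bar> \<le> \<bar>((t powr \<delta> - x powr \<delta>) / \<delta>) / t\<^sup>2\<bar> + \<bar>(1 + \<gamma> * (1 - \<delta>)) * t powr (\<delta> - 2)\<bar>"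
      by (metis abs_triangle_ineq4)
    also have "\<bar>((t powr \<delta> - x powr \<delta>) / \<delta>) / t\<^sup>2\<bar> \<le> 8 * (x powr (1/4) * t powr (1/4)) / t\<^sup>2"
      unfolding abs_divide[of _ "t\<^sup>2"] abs_power2
      by (intro divide_right_mono powr_diff_div_abs_le x \<delta> t) auto
    also have "\<dots> = 8 * (x powr (1/4) * (t powr (1/4) / t\<^sup>2))" by simp
    also have "t powr (1/4) / t\<^sup>2 = t powr (-7/4)"
      using t powr_diff[of t "1/4" 2] by (simp add: powr_numeral)
    also have "\<bar>(1 + \<gamma> * (1 - \<delta>)) * t powr (\<delta> - 2)\<bar> \<le> 2 * t powr (-7/4)"
    proof -
      have "\<gamma> * (1 - \<delta>) \<le> 1" using \<gamma> \<delta> by (intro mult_le_one) auto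
      moreover have "\<gamma> * (1 - \<delta>) \<ge> 0" using \<gamma> \<delta> by simp
      ultimately show ?thesis unfolding abs_mult using \<delta> t by (intro mult_mono) (auto intro!: powr_mono)
    qed
    also have "2 * t powr (-7/4) \<le> 2 * (x powr (1/4) * t powr (-7/4))"
      using x4 mult_right_mono[of 1 "x powr (1/4)" "t powr (-7/4)"] by simp
    finally have "\<bar>g' t\<bar> \<le> 10 * (x powr (1/4) * t powr (-7/4))" by simp
    also have "\<dots> \<le> - G' t" by (simp add: G'_def)
    finally show ?thesis .
  qed
  assume ab: "1 \<le> a" "a \<le> b"
  \<comment> \<open>Both \<open>G - g\<close> and \<open>G + g\<close> are nonincreasing, which
    together is the claim.\<close>
  have "(\<lambda>t. G t - g t) b \<le> (\<lambda>t. G t - g t) a"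
  proof (rule DERIV_nonpos_imp_nonincreasing[OF ab(2)])
    fix t assume "a \<le> t" "t \<le> b"
    thus "\<exists>y. ((\<lambda>t. G t - g t) has_real_derivative y) (at t) \<and> y \<le> 0"
      using ab bd[of t] by (intro exI[of _ "G' t - g' t"] conjI DERIV_diff G' g') auto
  qed
  moreover have "(\<lambda>t. G t + g t) b \<le> (\<lambda>t. G t + g t) a"
  proof (rule DERIV_nonpos_imp_nonincreasing[OF ab(2)])
    fix t assume "a \<le> t" "t \<le> b"
    thus "\<exists>y. ((\<lambda>t. G t + g t) has_real_derivative y) (at t) \<and> y \<le> 0"
      using ab bd[of t] by (intro exI[of _ "G' t + g' t"] conjI DERIV_add G' g') auto
  qed
  ultimately show "\<bar>g a - g b\<bar> \<le> G a - G b" by simp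
qed

section \<open>The hyperbola method at a zero\<close>

lemma sum_divisors_eq_sum_pairs:
  fixes h :: "nat \<Rightarrow> nat \<Rightarrow> real"
  shows "(\<Sum>n=1..x. \<Sum>b | b dvd n. h (n div b) b) = (\<Sum>(a, b) | a > 0 \<and> b > 0 \<and> a * b \<le> x. h a b)"
proof -
  have "(\<Sum>n=1..x. \<Sum>b | b dvd n. h (n div b) b) = (\<Sum>(n, b)\<in>(SIGMA n:{1..x}. {b. b dvd n}). h (n div b) b)"
    by (subst sum.Sigma) (auto intro: finite_divisors_nat)
  also have "\<dots> = (\<Sum>(a, b) | a > 0 \<and> b > 0 \<and> a * b \<le> x. h a b)"
    by (rule sum.reindex_bij_witness[of _ "\<lambda>(a, b). (a * b, b)" "\<lambda>(n, b). (n div b, b)"])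
      (auto elim!: dvdE simp: mult.commute)
  finally show ?thesis .
qed

text \<open>For \<open>b > N\<close> the condition \<open>a * b \<le> N^2\<close> forces
  \<open>a \<le> N\<close>. The square cutoff lets one threshold serve both variables.\<close>

lemma sum_pairs_hyperbola:
  fixes h :: "nat \<Rightarrow> nat \<Rightarrow> real"
  assumes "N > 0"
  shows "(\<Sum>(a, b) | a > 0 \<and> b > 0 \<and> a * b \<le> N\<^sup>2. h a b) =
    (\<Sum>b=1..N. \<Sum>a=1..N\<^sup>2 div b. h a b) + (\<Sum>a=1..N. \<Sum>b\<in>{N<..N\<^sup>2 div a}. h a b)"
proof -
  let ?T = "{(a, b). a > 0 \<and> b > 0 \<and> a * b \<le> N\<^sup>2}"
  let ?T1 = "prod.swap ` (SIGMA b:{1..N}. {1..N\<^sup>2 div b})"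
  let ?T2 = "SIGMA a:{1..N}. {N<..N\<^sup>2 div a}"
  have dv: "a \<le> N\<^sup>2 div b \<longleftrightarrow> a * b \<le> N\<^sup>2" if "b > 0" for a b
    using that by (simp add: less_eq_div_iff_mult_less_eq)
  have aN: "a \<le> N" if "N < b" "a * b \<le> N\<^sup>2" for a b
  proof (rule ccontr)
    assume "\<not> a \<le> N"
    hence "N * N < a * b" using that by (intro mult_strict_mono) auto
    thus False using that by (simp add: power2_eq_square)
  qed
  have "?T = ?T1 \<union> ?T2"
  proof (intro equalityI subsetI)
    fix y assume y: "y \<in> ?T"
    obtain a b where ab: "y = (a, b)" by (cases y)
    show "y \<in> ?T1 \<union> ?T2"
    proof (cases "b \<le> N")
      case True
      hence "(b, a) \<in> (SIGMA b:{1..N}. {1..N\<^sup>2 div b})" using y dv[of b a] by (auto simp: ab)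
      thus ?thesis unfolding ab by force
    next
      case False
      thus ?thesis using y aN[of b a] dv[of a b] by (auto simp: ab mult.commute)
    qed
  next
    fix y assume "y \<in> ?T1 \<union> ?T2"
    thus "y \<in> ?T" using dv by (auto simp: mult.commute)
  qed
  moreover have "?T1 \<inter> ?T2 = {}" by auto
  ultimately have "(\<Sum>(a, b)\<in>?T. h a b) = (\<Sum>(a, b)\<in>?T1. h a b) + (\<Sum>(a, b)\<in>?T2. h a b)"
    by (simp add: sum.union_disjoint)
  also have "(\<Sum>(a, b)\<in>?T1. h a b) = (\<Sum>(b, a)\<in>(SIGMA b:{1..N}. {1..N\<^sup>2 div b}). h a b)"
    by (subst sum.reindex) (auto simp: case_prod_unfold)
  also have "\<dots> = (\<Sum>b=1..N. \<Sum>a=1..N\<^sup>2 div b. h a b)" by (subst sum.Sigma) auto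
  also have "(\<Sum>(a, b)\<in>?T2. h a b) = (\<Sum>a=1..N. \<Sum>b\<in>{N<..N\<^sup>2 div a}. h a b)"
    by (subst sum.Sigma) auto
  finally show ?thesis .
qed

context real_character
begin

lemma abs_sum_c_interval_le: "\<bar>\<Sum>n\<in>{N<..K}. c n\<bar> \<le> 2 * real D"
proof (cases "N \<le> K")
  case True
  thus ?thesis using sum_split_greaterThanAtMost[OF True, of c] abs_sum_c_le[of K] abs_sum_c_le[of N]
    by linarith
qed simp

text \<open>Abel summation with partial sums at most \<open>2 * D\<close>; the variation of
  \<open>g\<close> is dominated by that of \<open>G\<close>, which telescopes.\<close>

lemma abs_sum_c_mult_le:
  fixes g G :: "nat \<Rightarrow> real"
  assumes "\<And>b. b > N \<Longrightarrow> \<bar>g b - g (Suc b)\<bar> \<le> G b - G (Suc b)" "\<And>b. b > N \<Longrightarrow> \<bar>g b\<bar> \<le> G b"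
  shows "\<bar>\<Sum>b\<in>{N<..K}. c b * g b\<bar> \<le> 2 * real D * G (Suc N)"
proof (cases "N \<le> K")
  case True
  define A where "A b = (\<Sum>n\<in>{N<..b}. c n)" for b
  have set_Suc: "{N<..Suc K} = insert (Suc K) {N<..K}" if "N \<le> K" for K using that by auto
  have abel: "(\<Sum>b\<in>{N<..K}. c b * g b) = A K * g (Suc K) + (\<Sum>b\<in>{N<..K}. A b * (g b - g (Suc b)))"
    using True
  proof (induction K rule: dec_induct)
    case base
    show ?case by (simp add: A_def)
  next
    case (step K)
    have "A (Suc K) = A K + c (Suc K)" using step(1) by (simp add: A_def set_Suc)
    thus ?case using step by (simp add: set_Suc algebra_simps)
  qed
  have tele: "(\<Sum>b\<in>{N<..K}. G b - G (Suc b)) = G (Suc N) - G (Suc K)"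
    using True by (induction K rule: dec_induct) (simp_all add: set_Suc)
  have "\<bar>\<Sum>b\<in>{N<..K}. c b * g b\<bar> \<le> \<bar>A K * g (Suc K)\<bar> + (\<Sum>b\<in>{N<..K}. \<bar>A b * (g b - g (Suc b))\<bar>)"
    unfolding abel by (rule order_trans[OF abs_triangle_ineq add_left_mono[OF sum_abs]])
  also have "\<dots> \<le> 2 * real D * G (Suc K) + (\<Sum>b\<in>{N<..K}. 2 * real D * (G b - G (Suc b)))"
    using assms True abs_sum_c_interval_le unfolding abs_mult A_def
    by (intro add_mono sum_mono mult_mono) auto
  also have "\<dots> = 2 * real D * G (Suc N)"
    by (simp only: sum_distrib_left[symmetric] tele) (simp add: algebra_simps)
  finally show ?thesis .
next
  case False
  have "0 \<le> G (Suc N)" using assms(2)[of "Suc N"] by linarith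
  thus ?thesis using False by simp
qed

text \<open>Partial sums of the series of \<open>zeta * L\<close> at \<open>1 - \<delta>\<close>,
  the zero in the application.\<close>

definition F :: "real \<Rightarrow> nat \<Rightarrow> real" where
  "F \<delta> x = (\<Sum>n=1..x. r n * real n powr (\<delta> - 1))"

lemma F_square_eq:
  assumes "N > 0"
  shows "F \<delta> (N\<^sup>2) = (\<Sum>b=1..N. c b * real b powr (\<delta> - 1) * (\<Sum>a=1..N\<^sup>2 div b. real a powr (\<delta> - 1))) +
     (\<Sum>a=1..N. real a powr (\<delta> - 1) * (\<Sum>b\<in>{N<..N\<^sup>2 div a}. c b * real b powr (\<delta> - 1)))"
proof -
  define h where "h a b = real a powr (\<delta> - 1) * (c b * real b powr (\<delta> - 1))" for a b
  have "F \<delta> (N\<^sup>2) = (\<Sum>n=1..N\<^sup>2. \<Sum>b | b dvd n. h (n div b) b)"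
    unfolding F_def r_def sum_distrib_right
  proof (intro sum.cong refl)
    fix n b assume "n \<in> {1..N\<^sup>2}" "b \<in> {b. b dvd n}"
    hence "real n = real (n div b) * real b" by (simp add: of_nat_mult[symmetric] del: of_nat_mult)
    hence "real n powr (\<delta> - 1) = real (n div b) powr (\<delta> - 1) * real b powr (\<delta> - 1)"
      by (simp add: powr_mult)
    thus "c b * real n powr (\<delta> - 1) = h (n div b) b" by (simp add: h_def)
  qed
  also have "\<dots> = (\<Sum>b=1..N. \<Sum>a=1..N\<^sup>2 div b. h a b) + (\<Sum>a=1..N. \<Sum>b\<in>{N<..N\<^sup>2 div a}. h a b)"
    unfolding sum_divisors_eq_sum_pairs by (rule sum_pairs_hyperbola[OF assms])
  finally show ?thesis by (simp add: h_def sum_distrib_left sum_distrib_right mult_ac)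
qed

text \<open>The part of the hyperbola formula with \<open>b \<le> N\<close> is nearly the sum of
  \<open>c b * g b\<close>. Completed to all \<open>b\<close> this sum is exactly
  \<open>x powr \<delta> * L1 / \<delta>\<close>, because the rest of \<open>g\<close> multiplies
  the series that vanishes at the zero. The part with \<open>b > N\<close> is small by Abel
  summation.\<close>

lemma F_asymptotics:
  fixes \<delta> L1 :: real
  assumes \<delta>: "0 < \<delta>" "\<delta> \<le> 1/8" and N: "N > 0"
    and L1: "(\<lambda>n. c (Suc n) / real (Suc n)) sums L1"
    and zero: "(\<lambda>n. c (Suc n) * real (Suc n) powr (\<delta> - 1)) sums 0"
  shows "\<bar>F \<delta> (N\<^sup>2) - real (N\<^sup>2) powr \<delta> * L1 / \<delta>\<bar> \<le> 64 * real D * real N powr (-1/4)"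
proof -
  define x where "x = real (N\<^sup>2)"
  have N1: "real N \<ge> 1" using N by simp
  have x1: "x \<ge> 1" using N by (simp add: x_def)
  have D1: "real D \<ge> 1" using D_ge_1 by simp
  obtain \<gamma> where \<gamma>: "0 \<le> \<gamma>" "\<gamma> \<le> 1" and
    Z: "\<And>z. z \<ge> 1 \<Longrightarrow> \<bar>(\<Sum>a=1..nat \<lfloor>z\<rfloor>. real a powr (\<delta> - 1)) - ((z powr \<delta> - 1) / \<delta> + \<gamma>)\<bar> \<le> 2 * z powr (\<delta> - 1)"
    using sum_powr_asymptotics[of \<delta>] \<delta> by auto
  define g where "g t = (x powr \<delta> / t - t powr (\<delta> - 1)) / \<delta> + \<gamma> * t powr (\<delta> - 1)" for t
  define G where "G t = 14 * x powr (1/4) * t powr (-3/4)" for t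
  note kernel = kernel_bounds[OF x1 \<delta> \<gamma>, folded g_def G_def]
  define Np where "Np = real N powr (-1/4)"
  have Np: "real N powr y \<le> Np" if "y \<le> -1/4" for y
    unfolding Np_def using N1 that by (intro powr_mono) auto

  have tail: "\<bar>\<Sum>b\<in>{N<..K}. c b * g (real b)\<bar> \<le> 28 * real D * Np" for K
  proof -
    have "\<bar>\<Sum>b\<in>{N<..K}. c b * g (real b)\<bar> \<le> 2 * real D * G (real (Suc N))"
      by (rule abs_sum_c_mult_le[where G = "\<lambda>b. G (real b)"]) (auto intro!: kernel)
    also have "\<dots> \<le> 2 * real D * (14 * Np)"
    proof (rule mult_left_mono)
      have "G (real (Suc N)) \<le> 14 * x powr (1/4) * real N powr (-3/4)"
        unfolding G_def using N1 by (intro mult_left_mono powr_mono2') auto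
      also have "x powr (1/4) = real N powr (2/4)"
        using N1 unfolding x_def by (simp add: powr_powr flip: powr_numeral)
      also have "14 * real N powr (2/4) * real N powr (-3/4) = 14 * Np"
        unfolding Np_def using N1 by (simp add: powr_add[symmetric])
      finally show "G (real (Suc N)) \<le> 14 * Np" .
    qed simp
    finally show ?thesis by simp
  qed
  have lim: "(\<lambda>K. \<Sum>b=1..K. c b * g (real b)) \<longlonglongrightarrow> x powr \<delta> * L1 / \<delta>"
  proof -
    \<comment> \<open>The kernel splits into a multiple of \<open>1 / t\<close> and
      \<open>\<gamma> - 1 / \<delta>\<close> times \<open>t powr (\<delta> - 1)\<close>. Each piece
      may be large, but only the exact limits are used here.\<close>
    have "(\<lambda>n. x powr \<delta> / \<delta> * (c (Suc n) / real (Suc n)) + (\<gamma> - 1 / \<delta>) * (c (Suc n) * real (Suc n) powr (\<delta> - 1)))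
       sums (x powr \<delta> / \<delta> * L1 + (\<gamma> - 1 / \<delta>) * 0)"
      by (intro sums_add sums_mult L1 zero)
    also have "(\<lambda>n. x powr \<delta> / \<delta> * (c (Suc n) / real (Suc n)) + (\<gamma> - 1 / \<delta>) * (c (Suc n) * real (Suc n) powr (\<delta> - 1)))
       = (\<lambda>n. c (Suc n) * g (real (Suc n)))"
      by (rule ext) (simp only: g_def, simp add: algebra_simps diff_divide_distrib)
    finally have "(\<lambda>K. \<Sum>n<K. c (Suc n) * g (real (Suc n))) \<longlonglongrightarrow> x powr \<delta> * L1 / \<delta>" by (simp add: sums_def)
    moreover have "(\<Sum>n<K. c (Suc n) * g (real (Suc n))) = (\<Sum>b=1..K. c b * g (real b))" for K
      by (rule sum.reindex_bij_witness[of _ "\<lambda>b. b - 1" Suc]) auto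
    ultimately show ?thesis by simp
  qed
  have 1: "\<bar>x powr \<delta> * L1 / \<delta> - (\<Sum>b=1..N. c b * g (real b))\<bar> \<le> 28 * real D * Np"
  proof (rule LIMSEQ_le_const2)
    show "(\<lambda>K. \<bar>(\<Sum>b=1..K. c b * g (real b)) - (\<Sum>b=1..N. c b * g (real b))\<bar>) \<longlonglongrightarrow>
       \<bar>x powr \<delta> * L1 / \<delta> - (\<Sum>b=1..N. c b * g (real b))\<bar>"
      by (intro tendsto_intros lim)
    show "\<exists>N'. \<forall>K\<ge>N'. \<bar>(\<Sum>b=1..K. c b * g (real b)) - (\<Sum>b=1..N. c b * g (real b))\<bar> \<le> 28 * real D * Np"
    proof (intro exI allI impI)
      fix K assume "N \<le> K"
      hence "(\<Sum>b=1..K. c b * g (real b)) - (\<Sum>b=1..N. c b * g (real b)) = (\<Sum>b\<in>{N<..K}. c b * g (real b))"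
        using sum_split_greaterThanAtMost[of N K "\<lambda>b. c b * g (real b)"] by simp
      thus "\<bar>(\<Sum>b=1..K. c b * g (real b)) - (\<Sum>b=1..N. c b * g (real b))\<bar> \<le> 28 * real D * Np"
        using tail[of K] by simp
    qed
  qed

  define A where "A = (\<Sum>b=1..N. c b * real b powr (\<delta> - 1) * (\<Sum>a=1..N\<^sup>2 div b. real a powr (\<delta> - 1)))"
  \<comment> \<open>Each of the \<open>N\<close> values of \<open>b\<close> contributes the error
    \<open>2 * x powr (\<delta> - 1)\<close> of its inner power sum.\<close>
  have 2: "\<bar>A - (\<Sum>b=1..N. c b * g (real b))\<bar> \<le> 2 * Np"
  proof -
    have "\<bar>A - (\<Sum>b=1..N. c b * g (real b))\<bar> \<le> (\<Sum>b=1..N. 2 * x powr (\<delta> - 1))"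
      unfolding A_def sum_subtractf[symmetric]
    proof (rule order_trans[OF sum_abs sum_mono])
      fix b assume b: "b \<in> {1..N}"
      hence b1: "real b \<ge> 1" by simp
      have "real b \<le> x"
        using b N by (simp add: x_def power2_eq_square flip: of_nat_mult)
          (metis le_square le_trans)
      hence z1: "x / real b \<ge> 1" using b1 by simp
      have fl: "nat \<lfloor>x / real b\<rfloor> = N\<^sup>2 div b" by (simp only: x_def floor_divide_of_nat_eq nat_int)
      have "g (real b) = real b powr (\<delta> - 1) * (((x / real b) powr \<delta> - 1) / \<delta> + \<gamma>)"
        using b1 x1 \<delta> by (simp add: g_def powr_divide powr_diff field_simps)
      hence "c b * real b powr (\<delta> - 1) * (\<Sum>a=1..N\<^sup>2 div b. real a powr (\<delta> - 1)) - c b * g (real b) =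
        c b * (real b powr (\<delta> - 1) * ((\<Sum>a=1..N\<^sup>2 div b. real a powr (\<delta> - 1)) - (((x / real b) powr \<delta> - 1) / \<delta> + \<gamma>)))"
        by (simp add: algebra_simps)
      also have "\<bar>\<dots>\<bar> \<le> 1 * (real b powr (\<delta> - 1) * (2 * (x / real b) powr (\<delta> - 1)))"
        unfolding abs_mult using Z[OF z1] abs_c_le_1 unfolding fl by (intro mult_mono) auto
      also have "\<dots> = 2 * x powr (\<delta> - 1)" using b1 x1 by (simp add: powr_divide)
      finally show "\<bar>c b * real b powr (\<delta> - 1) * (\<Sum>a=1..N\<^sup>2 div b. real a powr (\<delta> - 1)) - c b * g (real b)\<bar>
        \<le> 2 * x powr (\<delta> - 1)" .
    qed
    also have "\<dots> = 2 * (real N * x powr (\<delta> - 1))" by simp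
    also have "real N * x powr (\<delta> - 1) = real N powr 1 * real N powr (2 * (\<delta> - 1))"
      using N1 unfolding x_def by (simp add: powr_powr flip: powr_numeral)
    also have "\<dots> = real N powr (2 * \<delta> - 1)"
      by (simp only: powr_add[symmetric]) (simp add: algebra_simps)
    also have "\<dots> \<le> Np" using \<delta> by (intro Np) auto
    finally show ?thesis by simp
  qed

  define B where "B = (\<Sum>a=1..N. real a powr (\<delta> - 1) * (\<Sum>b\<in>{N<..N\<^sup>2 div a}. c b * real b powr (\<delta> - 1)))"
  have 3: "\<bar>B\<bar> \<le> 22 * real D * Np"
  proof -
    have inner: "\<bar>\<Sum>b\<in>{N<..K}. c b * real b powr (\<delta> - 1)\<bar> \<le> 2 * real D * real N powr (\<delta> - 1)" for K
    proof -
      have "\<bar>\<Sum>b\<in>{N<..K}. c b * real b powr (\<delta> - 1)\<bar> \<le> 2 * real D * real (Suc N) powr (\<delta> - 1)"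
        by (rule abs_sum_c_mult_le) (use \<delta> in \<open>auto intro!: powr_mono2'\<close>)
      also have "\<dots> \<le> 2 * real D * real N powr (\<delta> - 1)"
        using N1 \<delta> by (intro mult_left_mono powr_mono2') auto
      finally show ?thesis .
    qed
    have "\<bar>B\<bar> \<le> (\<Sum>a=1..N. real a powr (\<delta> - 1) * (2 * real D * real N powr (\<delta> - 1)))"
      unfolding B_def
    proof (rule order_trans[OF sum_abs sum_mono])
      fix a
      show "\<bar>real a powr (\<delta> - 1) * (\<Sum>b\<in>{N<..N\<^sup>2 div a}. c b * real b powr (\<delta> - 1))\<bar> \<le>
         real a powr (\<delta> - 1) * (2 * real D * real N powr (\<delta> - 1))"
        unfolding abs_mult using inner[of "N\<^sup>2 div a"] by (intro mult_mono) auto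
    qed
    also have "\<dots> = (\<Sum>a=1..N. real a powr (\<delta> - 1)) * (2 * real D * real N powr (\<delta> - 1))"
      by (simp add: sum_distrib_right)
    \<comment> \<open>Here 11 = 8 + 1 + 2, from the main term, \<open>\<gamma>\<close> and the error
      in \<open>Z\<close>.\<close>
    also have "(\<Sum>a=1..N. real a powr (\<delta> - 1)) \<le> 11 * real N powr (1/4)"
    proof -
      have "real N powr (1/4) \<ge> 1" using N1 by (intro ge_one_powr_ge_zero) auto
      moreover have "real N powr (\<delta> - 1) \<le> real N powr 0" using N1 \<delta> by (intro powr_mono) auto
      ultimately show ?thesis using Z[OF N1] powr_minus_one_div_le[OF N1 \<delta>] \<gamma> N1 by simp
    qed
    hence "(\<Sum>a=1..N. real a powr (\<delta> - 1)) * (2 * real D * real N powr (\<delta> - 1)) \<le>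
       11 * real N powr (1/4) * (2 * real D * real N powr (\<delta> - 1))"
      by (intro mult_right_mono) auto
    also have "\<dots> = 22 * real D * real N powr (1/4 + (\<delta> - 1))"
      by (simp only: powr_add) simp
    also have "\<dots> \<le> 22 * real D * Np" using \<delta> by (intro mult_left_mono Np) auto
    finally show ?thesis .
  qed

  have FAB: "F \<delta> (N\<^sup>2) = A + B" unfolding A_def B_def by (rule F_square_eq[OF N])
  have tri: "\<bar>A + B - M\<bar> \<le> \<bar>M - T\<bar> + \<bar>A - T\<bar> + \<bar>B\<bar>" for M T by linarith
  have "\<bar>F \<delta> (N\<^sup>2) - x powr \<delta> * L1 / \<delta>\<bar> \<le> 28 * real D * Np + 2 * Np + 22 * real D * Np"
    unfolding FAB by (rule order_trans[OF tri add_mono[OF add_mono[OF 1 2] 3]])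
  also have "\<dots> \<le> 64 * real D * Np"
  proof -
    have "Np \<le> real D * Np" using D1 mult_right_mono[of 1 "real D" Np] by (simp add: Np_def)
    moreover have "real D * Np \<ge> 0" by (simp add: Np_def)
    ultimately show ?thesis by linarith
  qed
  finally show ?thesis by (simp add: x_def Np_def)
qed

end

section \<open>Flatness of the logarithmic sum\<close>

context real_character
begin

lemma S_ge_1:
  assumes "x \<ge> 1"
  shows "1 \<le> S x"
proof -
  have "(\<Sum>n\<in>{1}. r n / real n) \<le> S x"
    unfolding S_def using assms by (intro sum_mono2) (auto intro!: divide_nonneg_nonneg r_nonneg)
  thus ?thesis using r_one by simp
qed

text \<open>Termwise \<open>1 / n \<le> n powr (\<delta> - 1)\<close>, with \<open>r\<close>
  nonnegative.\<close>

lemma S_diff_le_F_diff: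
  assumes "x \<le> y" "\<delta> > 0"
  shows "S y - S x \<le> F \<delta> y - F \<delta> x"
proof -
  have "(\<Sum>n\<in>{x<..y}. r n / real n) \<le> (\<Sum>n\<in>{x<..y}. r n * real n powr (\<delta> - 1))"
  proof (rule sum_mono)
    fix n assume n: "n \<in> {x<..y}"
    have "1 / real n = real n powr (-1)" using n by (simp add: powr_minus divide_inverse)
    also have "\<dots> \<le> real n powr (\<delta> - 1)" using n assms by (intro powr_mono) auto
    finally show "r n / real n \<le> r n * real n powr (\<delta> - 1)"
      using r_nonneg[of n] n mult_left_mono[of "1 / real n" "real n powr (\<delta> - 1)" "r n"] by simp
  qed
  thus ?thesis unfolding S_def F_def
    using sum_split_greaterThanAtMost[OF assms(1), of "\<lambda>n. r n / real n"]
      sum_split_greaterThanAtMost[OF assms(1), of "\<lambda>n. r n * real n powr (\<delta> - 1)"] by linarith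
qed

lemma F_le_S:
  assumes "\<delta> > 0"
  shows "F \<delta> x \<le> real x powr \<delta> * S x"
  unfolding F_def S_def sum_distrib_left
proof (rule sum_mono)
  fix n assume n: "n \<in> {1..x}"
  have "real n powr (\<delta> - 1) = real n powr \<delta> / real n" using n by (simp add: powr_diff)
  also have "\<dots> \<le> real x powr \<delta> / real n" using n assms by (intro divide_right_mono powr_mono2) auto
  finally show "r n * real n powr (\<delta> - 1) \<le> real x powr \<delta> * (r n / real n)"
    using r_nonneg[of n] n mult_left_mono[of "real n powr (\<delta> - 1)" "real x powr \<delta> / real n" "r n"]
    by (simp add: mult.commute)
qed

context
  fixes \<delta> L1 :: real and N :: nat
  assumes \<delta>: "0 < \<delta>" "\<delta> \<le> 1/8" and D4: "D \<ge> 4"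
    and L1: "(\<lambda>n. c (Suc n) / real (Suc n)) sums L1"
    and zero: "(\<lambda>n. c (Suc n) * real (Suc n) powr (\<delta> - 1)) sums 0"
    and N: "D ^ 20 \<le> N"
begin

text \<open>From \<open>D ^ 20 \<le> M\<close> the power \<open>M powr (-1/4)\<close> is at most
  \<open>D powr (-5)\<close>, and \<open>64 \<le> D ^ 3\<close> absorbs the constant.\<close>

lemma F_approx:
  assumes "N \<le> M"
  shows "\<bar>F \<delta> (M\<^sup>2) - real (M\<^sup>2) powr \<delta> * L1 / \<delta>\<bar> \<le> 1 / real D"
proof -
  have "real D ^ 20 \<le> real M" using N assms by (metis of_nat_le_iff of_nat_power le_trans)
  moreover have "real D ^ 20 > 0" using D4 by simp
  ultimately have "real M powr (-1/4) \<le> (real D ^ 20) powr (-1/4)" by (intro powr_mono2') auto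
  also have "(real D ^ 20) powr (-1/4) = real D powr (-5)"
    using D4 by (simp add: powr_powr flip: powr_numeral)
  also have "\<dots> = 1 / real D ^ 5" using D4 by (simp add: powr_minus_divide powr_numeral)
  finally have "64 * real D * real M powr (-1/4) \<le> 64 * real D * (1 / real D ^ 5)"
    by (intro mult_left_mono) auto
  also have "\<dots> \<le> real D ^ 3 * real D * (1 / real D ^ 5)"
    using power_mono[of 4 "real D" 3] D4 by (intro mult_right_mono) auto
  also have "\<dots> = 1 / real D" using D4 by (simp add: field_simps eval_nat_numeral)
  finally have "64 * real D * real M powr (-1/4) \<le> 1 / real D" .
  moreover have "M > 0" using N assms D4 by (intro gr0I) auto
  ultimately show ?thesis using F_asymptotics[OF \<delta> _ L1 zero, of M] by linarith
qed

lemma N_pos: "N > 0"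
  using N D4 by (intro gr0I) auto

text \<open>The asymptotics at \<open>N^2\<close> bound \<open>L1 / \<delta>\<close> by
  \<open>2 * S (N^2) + 1\<close>, and \<open>S (N^2)\<close> is at least 1. A negative
  \<open>L1\<close> is trivial.\<close>

lemma L1_le_S:
  assumes "real (N\<^sup>2) powr \<delta> \<le> 2"
  shows "L1 \<le> 4 * \<delta> * S (N\<^sup>2)"
proof -
  have S1: "S (N\<^sup>2) \<ge> 1" using N_pos by (intro S_ge_1) simp
  show ?thesis
  proof (cases "L1 \<ge> 0")
    case True
    have "1 \<le> real (N\<^sup>2) powr \<delta>" using N_pos \<delta> by (intro ge_one_powr_ge_zero) auto
    hence "1 * (L1 / \<delta>) \<le> real (N\<^sup>2) powr \<delta> * (L1 / \<delta>)" using True \<delta> by (intro mult_right_mono) auto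
    also have "\<dots> \<le> F \<delta> (N\<^sup>2) + 1 / real D" using F_approx[of N] by simp
    also have "F \<delta> (N\<^sup>2) \<le> real (N\<^sup>2) powr \<delta> * S (N\<^sup>2)" by (rule F_le_S[OF \<delta>(1)])
    also have "\<dots> \<le> 2 * S (N\<^sup>2)" using assms S1 by (intro mult_right_mono) auto
    also have "1 / real D \<le> 1" using D4 by simp
    finally have "L1 / \<delta> \<le> 4 * S (N\<^sup>2)" using S1 by simp
    thus ?thesis using \<delta> by (simp add: field_simps)
  next
    case False
    have "0 \<le> 4 * \<delta> * S (N\<^sup>2)" using \<delta> S1 by simp
    thus ?thesis using False by linarith
  qed
qed

text \<open>The increment of \<open>S\<close> is at most that of \<open>F\<close>, which is
  \<open>L1\<close> times a difference quotient of size at most \<open>2 * ln y\<close>, up to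
  errors. The decisive factor \<open>\<delta>\<close> comes from \<open>L1_le_S\<close>.\<close>

lemma S_flat:
  assumes "N \<le> M" "real (M\<^sup>2) powr \<delta> \<le> 2"
  shows "S (M\<^sup>2) - S (N\<^sup>2) \<le> (8 * \<delta> * ln (real (M\<^sup>2)) + 2 / real D) * S (N\<^sup>2)"
proof -
  define x y where "x = real (N\<^sup>2)" and "y = real (M\<^sup>2)"
  have S1: "S (N\<^sup>2) \<ge> 1" using N_pos by (intro S_ge_1) simp
  have xy: "1 \<le> x" "x \<le> y" using N_pos assms(1) by (auto simp: x_def y_def)
  have x2: "x powr \<delta> \<le> 2" using assms(2) xy \<delta> powr_mono2[of \<delta> x y] by (simp add: y_def)
  have "S (M\<^sup>2) - S (N\<^sup>2) \<le> F \<delta> (M\<^sup>2) - F \<delta> (N\<^sup>2)"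
    using assms \<delta> by (intro S_diff_le_F_diff) auto
  also have "\<dots> \<le> y powr \<delta> * L1 / \<delta> - x powr \<delta> * L1 / \<delta> + 2 / real D"
  proof -
    have "a - a' \<le> b - b' + 2 / real D"
      if "\<bar>a - b\<bar> \<le> 1 / real D" "\<bar>a' - b'\<bar> \<le> 1 / real D" for a b a' b'
      using that by linarith
    thus ?thesis unfolding x_def y_def using F_approx[OF assms(1)] F_approx[of N] by blast
  qed
  also have "y powr \<delta> * L1 / \<delta> - x powr \<delta> * L1 / \<delta> = (y powr \<delta> - x powr \<delta>) / \<delta> * L1"
    by (simp add: diff_divide_distrib left_diff_distrib)
  also have "\<dots> \<le> (y powr \<delta> - x powr \<delta>) / \<delta> * (4 * \<delta> * S (N\<^sup>2))"
    using L1_le_S x2 xy \<delta> by (intro mult_left_mono divide_nonneg_nonneg) (auto simp: x_def intro!: powr_mono2)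
  also have "\<dots> \<le> (2 * ln y) * (4 * \<delta> * S (N\<^sup>2))"
  proof (rule mult_right_mono)
    have "(y powr \<delta> - x powr \<delta>) / \<delta> \<le> (y powr \<delta> - 1) / \<delta>"
      using xy \<delta> by (intro divide_right_mono diff_left_mono ge_one_powr_ge_zero) auto
    also have "\<dots> \<le> ln y * y powr \<delta>" using xy \<delta> by (intro powr_minus_one_div_le_ln) auto
    also have "\<dots> \<le> ln y * 2" using assms(2) xy by (intro mult_left_mono) (auto simp: y_def)
    finally show "(y powr \<delta> - x powr \<delta>) / \<delta> \<le> 2 * ln y" by simp
  qed (use \<delta> S1 in auto)
  also have "2 / real D \<le> 2 / real D * S (N\<^sup>2)" using S1 mult_left_mono[of 1 "S (N\<^sup>2)" "2 / real D"] by simp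
  finally show ?thesis by (simp add: y_def algebra_simps)
qed

end

text \<open>All primes up to \<open>w\<close> are counted by the Mertens bound, which yields
  \<open>(1 + ln w)^2\<close>. The constant is 8 = 2 * 3 + 2.\<close>

lemma S_le_of_large_prime_sum:
  fixes w :: real
  assumes "w \<ge> 2" "Q > 0"
  shows "S Q \<le> exp (2 * (\<Sum>p | prime p \<and> w < real p \<and> p \<le> Q \<and> c p \<ge> 0. 1 / real p) + 8) * (1 + ln w)\<^sup>2"
proof -
  define P where "P = {p. prime p \<and> w < real p \<and> p \<le> Q \<and> c p \<ge> 0}"
  define m where "m = nat \<lfloor>w\<rfloor>"
  have m: "m \<ge> 2" "real m \<le> w" "w < real m + 1" using assms by (auto simp: m_def le_nat_floor)
  have lm: "ln (real m) \<le> ln w" "ln (real m) > 0" using m by auto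
  have fin: "finite P" "finite {p. prime p \<and> p \<le> m}" by (auto simp: P_def)
  have "(\<Sum>p | prime p \<and> p \<le> Q \<and> c p \<noteq> -1. 1 / real p) \<le> (\<Sum>p\<in>{p. prime p \<and> p \<le> m} \<union> P. 1 / real p)"
  proof (rule sum_mono2)
    show "{p. prime p \<and> p \<le> Q \<and> c p \<noteq> -1} \<subseteq> {p. prime p \<and> p \<le> m} \<union> P"
    proof
      fix p assume p: "p \<in> {p. prime p \<and> p \<le> Q \<and> c p \<noteq> -1}"
      have "c p \<ge> 0" using p c_values[of p] by auto
      moreover have "p \<le> m" if "real p \<le> w" using that by (simp add: m_def le_nat_floor)
      ultimately show "p \<in> {p. prime p \<and> p \<le> m} \<union> P" using p by (force simp: P_def)
    qed
  qed (use fin in auto)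
  also have "\<dots> \<le> (\<Sum>p | prime p \<and> p \<le> m. 1 / real p) + (\<Sum>p\<in>P. 1 / real p)"
    using fin by (simp add: sum_Un sum_nonneg)
  also have "(\<Sum>p | prime p \<and> p \<le> m. 1 / real p) \<le> ln (1 + ln (real m)) + 3"
    by (rule sum_inverse_primes_le[OF m(1)])
  also have "ln (1 + ln (real m)) \<le> ln (1 + ln w)" using lm by simp
  finally have "2 * (\<Sum>p | prime p \<and> p \<le> Q \<and> c p \<noteq> -1. 1 / real p) + 2 \<le>
      (2 * (\<Sum>p\<in>P. 1 / real p) + 8) + (ln (1 + ln w) + ln (1 + ln w))" by simp
  hence "S Q \<le> exp ((2 * (\<Sum>p\<in>P. 1 / real p) + 8) + (ln (1 + ln w) + ln (1 + ln w)))"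
    using S_le_exp_prime_sum[OF assms(2)] by (meson exp_le_cancel_iff order_trans)
  also have "\<dots> = exp (2 * (\<Sum>p\<in>P. 1 / real p) + 8) * (1 + ln w)\<^sup>2"
    using lm by (simp only: exp_add[of "2 * (\<Sum>p\<in>P. 1 / real p) + 8"] exp_add[of "ln (1 + ln w)"])
      (simp add: power2_eq_square)
  finally show ?thesis unfolding P_def .
qed

end

text \<open>
  In terms of \<open>l = ln D\<close>: \<open>C * ln l / l ^ 3\<close> bounds \<open>\<delta>\<close>, \<open>41 + 40 * sqrt (ln l)\<close> bounds \<open>k + 1\<close>, and
  \<open>40 * l * (k + 1)\<close> is the logarithm of \<open>Q ^ (k + 1)\<close>.
\<close>

lemma eventually_parameters:
  fixes C :: real
  assumes "C > 0"
  shows "\<forall>\<^sub>F l in at_top. C * ln l / l ^ 3 \<le> 1 / 8 \<and>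
     C * ln l / l ^ 3 * (40 * l * (41 + 40 * sqrt (ln l))) \<le> 1 / 2 \<and>
     l * (8 * (C * ln l / l ^ 3) * (40 * l * (41 + 40 * sqrt (ln l))) + 2 / exp l) < 1 \<and>
     2 * (41 + 40 * sqrt (ln l)) * ln (41 + 40 * sqrt (ln l)) < ln l \<and>
     1 + sqrt (ln l) \<le> l \<and> l \<ge> 4"
proof -
  \<comment> \<open>Limits are computed for functions free of \<open>C\<close>, which is reattached
    as a constant factor.\<close>
  have *: "\<forall>\<^sub>F l in at_top. C * f l < e" if "(f \<longlongrightarrow> 0) at_top" "e > 0" for f :: "real \<Rightarrow> real" and e
    using order_tendstoD(2)[OF tendsto_mult_right_zero[OF that(1), of C] that(2)] .
  have 1: "\<forall>\<^sub>F l in at_top. C * (ln l / l ^ 3) < 1 / 8"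
    by (rule *) (real_asymp, simp)
  have 2: "\<forall>\<^sub>F l in at_top. C * (ln l / l ^ 3 * (40 * l * (41 + 40 * sqrt (ln l)))) < 1 / 2"
    by (rule *) (real_asymp, simp)
  have 3: "\<forall>\<^sub>F l in at_top. C * (l * (8 * (ln l / l ^ 3) * (40 * l * (41 + 40 * sqrt (ln l))))) < 1 / 2"
    by (rule *) (real_asymp, simp)
  have 4: "\<forall>\<^sub>F l in at_top. l * (2 / exp l) < 1 / (2::real)"
    by real_asymp
  have 5: "\<forall>\<^sub>F l in at_top. 2 * (41 + 40 * sqrt (ln l)) * ln (41 + 40 * sqrt (ln l)) < ln (l::real)"
    by real_asymp
  have 6: "\<forall>\<^sub>F l in at_top. 1 + sqrt (ln l) \<le> (l::real)"
    by real_asymp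
  show ?thesis
    using 1 2 3 4 5 6 eventually_ge_at_top[of 4]
  proof eventually_elim
    case (elim l)
    have "l * (8 * (C * ln l / l ^ 3) * (40 * l * (41 + 40 * sqrt (ln l))) + 2 / exp l) =
      C * (l * (8 * (ln l / l ^ 3) * (40 * l * (41 + 40 * sqrt (ln l))))) + l * (2 / exp l)"
      by (simp add: distrib_left mult_ac)
    also have "\<dots> < 1" using elim by linarith
    finally show ?case using elim by (simp add: mult.assoc less_imp_le)
  qed
qed

section \<open>Combination of the estimates for large conductors\<close>

context real_character
begin

text \<open>The assumptions \<open>h1\<close> to \<open>h6\<close> are the inequalities of
  \<open>eventually_parameters\<close> at \<open>l\<close>, which keeps limits apart from
  arithmetic.\<close>

lemma L1_bound_large:
  fixes C \<delta> L1 :: real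
  defines "l \<equiv> ln (real D)"
  assumes C: "C > 0" and \<delta>: "0 < \<delta>" "\<delta> \<le> C * ln l / l ^ 3"
    and L1: "(\<lambda>n. c (Suc n) / real (Suc n)) sums L1"
    and zero: "(\<lambda>n. c (Suc n) * real (Suc n) powr (\<delta> - 1)) sums 0"
    and h1: "C * ln l / l ^ 3 \<le> 1 / 8"
    and h2: "C * ln l / l ^ 3 * (40 * l * (41 + 40 * sqrt (ln l))) \<le> 1 / 2"
    and h3: "l * (8 * (C * ln l / l ^ 3) * (40 * l * (41 + 40 * sqrt (ln l))) + 2 / exp l) < 1"
    and h4: "2 * (41 + 40 * sqrt (ln l)) * ln (41 + 40 * sqrt (ln l)) < ln l"
    and h5: "1 + sqrt (ln l) \<le> l" and h6: "l \<ge> 4"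
  shows "L1 \<le> 16 * exp 10 * C / l"
proof -
  have D0: "real D > 0" using D_ge_1 by simp
  have exp_l: "exp l = real D" using D0 by (simp add: l_def)
  have "real D \<ge> 4" using exp_ge_add_one_self[of l] h6 exp_l by linarith
  hence D4: "D \<ge> 4" by simp
  have lnl: "ln l > 0" using h6 by simp
  \<comment> \<open>Since \<open>w ^ u = D\<close>, the choice \<open>k = 40 * u\<close> gives
    \<open>w ^ k = D ^ 40 = N^2\<close>.\<close>
  define u where "u = nat \<lceil>sqrt (ln l)\<rceil>"
  define k where "k = 40 * u"
  define B where "B = 41 + 40 * sqrt (ln l)"
  define w where "w = exp (l / real u)"
  \<comment> \<open>\<open>N^2\<close> is the point \<open>Q\<close> of the introductory sketch, and
    \<open>M^2\<close> is \<open>Q ^ (k + 1)\<close>.\<close>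
  define N where "N = D ^ 20"
  define M where "M = N ^ (k + 1)"
  have sq: "sqrt (ln l) > 0" using lnl by simp
  have u: "u \<ge> 1" "sqrt (ln l) \<le> real u" "real u \<le> sqrt (ln l) + 1"
    using sq unfolding u_def by (auto simp: Suc_le_eq)
  have kB: "real (k + 1) \<le> B" using u(3) by (simp add: k_def B_def)
  have B1: "B \<ge> 1" using sq by (simp add: B_def)
  have N1: "N \<ge> 1" using D4 by (simp add: N_def)
  have NM: "N \<le> M" unfolding M_def using N1 by simp
  have M2: "M\<^sup>2 = (N\<^sup>2) ^ (k + 1)" by (simp only: M_def power_mult[symmetric] mult.commute)
  have lnN: "ln (real (N\<^sup>2)) = 40 * l"
    using D0 by (simp add: N_def l_def ln_realpow power_mult[symmetric])
  have lnM: "ln (real (M\<^sup>2)) = 40 * l * real (k + 1)"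
    unfolding M2 of_nat_power[of "N\<^sup>2"] using N1 lnN by (subst ln_realpow) auto
  have lnM_le: "\<delta> * ln (real (M\<^sup>2)) \<le> C * ln l / l ^ 3 * (40 * l * B)"
    unfolding lnM using \<delta> kB h6 by (intro mult_mono) auto
  have M_powr: "real (M\<^sup>2) powr \<delta> \<le> 2"
  proof -
    have "M > 0" using NM N1 by simp
    hence "real (M\<^sup>2) powr \<delta> = exp (\<delta> * ln (real (M\<^sup>2)))" by (simp add: powr_def)
    also have "\<dots> \<le> exp (1/2)" using lnM_le h2 unfolding B_def by simp
    finally show ?thesis using exp_half_le2 by simp
  qed
  have N_powr: "real (N\<^sup>2) powr \<delta> \<le> 2"
  proof -
    have "real (N\<^sup>2) \<le> real (M\<^sup>2)" using NM by simp
    hence "real (N\<^sup>2) powr \<delta> \<le> real (M\<^sup>2) powr \<delta>" using \<delta> by (intro powr_mono2) auto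
    thus ?thesis using M_powr by linarith
  qed
  have \<delta>8: "\<delta> \<le> 1/8" using \<delta> h1 by linarith
  have ND: "D ^ 20 \<le> N" by (simp add: N_def)
  have S1: "S (N\<^sup>2) \<ge> 1" using N1 by (intro S_ge_1) simp
  have L1_le: "L1 \<le> 4 * \<delta> * S (N\<^sup>2)"
    by (rule L1_le_S[OF \<delta>(1) \<delta>8 D4 L1 zero ND N_powr])
  have "S (M\<^sup>2) - S (N\<^sup>2) \<le> (8 * \<delta> * ln (real (M\<^sup>2)) + 2 / real D) * S (N\<^sup>2)"
    by (rule S_flat[OF \<delta>(1) \<delta>8 D4 L1 zero ND NM M_powr])
  also have "\<dots> < 1 / l * S (N\<^sup>2)"
  proof (rule mult_strict_right_mono)
    have "8 * \<delta> * ln (real (M\<^sup>2)) + 2 / real D \<le> 8 * (C * ln l / l ^ 3) * (40 * l * B) + 2 / exp l"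
      using lnM_le exp_l by simp
    also have "\<dots> < 1 / l" using h3 h6 unfolding B_def by (simp add: pos_less_divide_eq mult.commute)
    finally show "8 * \<delta> * ln (real (M\<^sup>2)) + 2 / real D < 1 / l" .
  qed (use S1 in simp)
  finally have flat: "S (M\<^sup>2) - S (N\<^sup>2) < 1 / l * S (N\<^sup>2)" .

  have lu: "l / real u \<ge> 1" using u h5 by (simp add: le_divide_eq)
  have w2: "w \<ge> 2" unfolding w_def using exp_ge_add_one_self[of "l / real u"] lu by linarith
  have wk: "real (N\<^sup>2) \<le> w ^ k"
  proof -
    have "w ^ k = exp (real k * (l / real u))" by (simp add: w_def exp_of_nat_mult[symmetric])
    also have "real k * (l / real u) = ln (real (N\<^sup>2))" using u(1) lnN by (simp add: k_def)
    also have "exp (ln (real (N\<^sup>2))) = real (N\<^sup>2)" using N1 by (intro exp_ln) simp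
    finally show ?thesis by simp
  qed
  define P where "P = {p. prime p \<and> w < real p \<and> p \<le> N\<^sup>2 \<and> c p \<ge> 0}"
  define W where "W = (\<Sum>p\<in>P. 1 / real p)"
  \<comment> \<open>Otherwise \<open>S\<close> would grow by the proportion
    \<open>(k + 1) ^ (-2 * k)\<close>. By \<open>h4\<close> this exceeds \<open>1 / l\<close>,
    against \<open>flat\<close>.\<close>
  have W1: "W < 1"
  proof (rule ccontr)
    assume "\<not> W < 1"
    hence W: "W \<ge> 1" by simp
    have "(W / real (k + 1) ^ 2) ^ k * S (N\<^sup>2) \<le> S (M\<^sup>2) - S (N\<^sup>2)"
      unfolding W_def M2 by (rule S_growth[where w = w]) (use w2 wk u in \<open>auto simp: P_def k_def\<close>)
    with flat have "(W / real (k + 1) ^ 2) ^ k * S (N\<^sup>2) < 1 / l * S (N\<^sup>2)" by linarith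
    moreover have "S (N\<^sup>2) > 0" using S1 by linarith
    ultimately have "(W / real (k + 1) ^ 2) ^ k < 1 / l" using mult_less_cancel_right_pos by blast
    moreover have "(1 / real (k + 1) ^ 2) ^ k \<le> (W / real (k + 1) ^ 2) ^ k"
      using W by (intro power_mono divide_right_mono) auto
    ultimately have "(1 / real (k + 1) ^ 2) ^ k < 1 / l" by linarith
    moreover have "(1 / real (k + 1) ^ 2) ^ k = 1 / real (k + 1) ^ (2 * k)"
      by (simp only: power_divide power_one power_mult)
    ultimately have "l < real (k + 1) ^ (2 * k)" using h6 by (simp add: divide_less_cancel field_simps)
    hence "ln l < ln (real (k + 1) ^ (2 * k))" using h6 by simp
    also have "\<dots> = 2 * real k * ln (real (k + 1))" by (simp add: ln_realpow del: of_nat_Suc)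
    also have "\<dots> \<le> 2 * B * ln B"
      using kB B1 by (intro mult_mono) auto
    also have "\<dots> < ln l" using h4 by (simp add: B_def)
    finally show False .
  qed
  have "S (N\<^sup>2) \<le> exp (2 * W + 8) * (1 + ln w)\<^sup>2"
    unfolding W_def P_def using w2 N1 by (intro S_le_of_large_prime_sum) auto
  \<comment> \<open>\<open>W < 1\<close> makes the exponent at most 10, and
    \<open>1 + ln w \<le> 2 * ln w\<close> because \<open>ln w = l / u \<ge> 1\<close>.\<close>
  also have "\<dots> \<le> exp 10 * (2 * (l / real u))\<^sup>2"
    using W1 lu by (intro mult_mono power_mono) (auto simp: w_def)
  also have "\<dots> = 4 * exp 10 * l\<^sup>2 / (real u)\<^sup>2" by (simp add: power_divide)
  \<comment> \<open>As \<open>u\<close> is at least \<open>sqrt (ln l)\<close>, this gains the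
    factor \<open>ln l\<close> that the bound on \<open>\<delta>\<close> loses.\<close>
  also have "\<dots> \<le> 4 * exp 10 * l\<^sup>2 / ln l"
  proof (rule divide_left_mono)
    show "ln l \<le> (real u)\<^sup>2" using u(2) lnl power_mono[of "sqrt (ln l)" "real u" 2] by simp
  qed (use lnl u(1) in auto)
  finally have S_le: "S (N\<^sup>2) \<le> 4 * exp 10 * l\<^sup>2 / ln l" .
  have "L1 \<le> 4 * (C * ln l / l ^ 3) * (4 * exp 10 * l\<^sup>2 / ln l)"
    by (rule order_trans[OF L1_le mult_mono]) (use \<delta> S_le S1 C lnl h6 in auto)
  also have "\<dots> = 16 * exp 10 * C / l"
    using lnl h6 by (simp add: field_simps power2_eq_square power3_eq_cube)
  finally show ?thesis .
qed

text \<open>A crude bound for the conductors below the threshold of the asymptotic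
  inequalities.\<close>

lemma L1_le_2D:
  assumes L1: "(\<lambda>n. c (Suc n) / real (Suc n)) sums L1"
  shows "L1 \<le> 2 * real D"
proof (rule LIMSEQ_le_const2)
  show "(\<lambda>K. \<Sum>n<K. c (Suc n) / real (Suc n)) \<longlonglongrightarrow> L1" using L1 by (simp add: sums_def)
  have "(\<Sum>n<K. c (Suc n) / real (Suc n)) \<le> 2 * real D" for K
  proof -
    have "(\<Sum>n<K. c (Suc n) / real (Suc n)) = (\<Sum>b\<in>{0<..K}. c b * (1 / real b))"
      by (rule sum.reindex_bij_witness[of _ "\<lambda>b. b - 1" Suc]) auto
    moreover have "\<bar>\<Sum>b\<in>{0<..K}. c b * (1 / real b)\<bar> \<le> 2 * real D * (1 / real (Suc 0))"
      by (rule abs_sum_c_mult_le) (auto simp: field_simps)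
    ultimately show ?thesis by simp
  qed
  thus "\<exists>N. \<forall>K\<ge>N. (\<Sum>n<K. c (Suc n) / real (Suc n)) \<le> 2 * real D" by blast
qed

end

section \<open>Analytic continuation and characters\<close>

text \<open>Mean value inequality on the segment between consecutive integers, where the derivative
  is largest at the left end.\<close>

lemma norm_powr_diff_le:
  fixes z :: complex
  assumes "Re z > 0"
  shows "norm (of_nat (Suc n) powr - z - of_nat (Suc (Suc n)) powr - z :: complex) \<le>
    norm z * real (Suc n) powr (- Re z - 1)"
proof -
  define T where "T = closed_segment (of_nat (Suc n)) (of_nat (Suc (Suc n)) :: complex)"
  have T: "\<exists>t. x = of_real t \<and> real (Suc n) \<le> t" if "x \<in> T" for x
  proof -
    have "x \<in> closed_segment (of_real (real (Suc n))) (of_real (real (Suc (Suc n))))"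
      using that unfolding T_def of_real_of_nat_eq .
    hence "x \<in> of_real ` closed_segment (real (Suc n)) (real (Suc (Suc n)))"
      by (simp only: closed_segment_of_real)
    thus ?thesis by (auto simp: closed_segment_eq_real_ivl)
  qed
  have "norm ((\<lambda>x. x powr - z) (of_nat (Suc n)) - (\<lambda>x. x powr - z) (of_nat (Suc (Suc n)))) \<le>
     (norm z * real (Suc n) powr (- Re z - 1)) * norm (of_nat (Suc n) - of_nat (Suc (Suc n)) :: complex)"
  proof (rule field_differentiable_bound[where S = T])
    show "convex T" "of_nat (Suc n) \<in> T" "of_nat (Suc (Suc n)) \<in> T" by (auto simp: T_def)
    fix x assume "x \<in> T"
    then obtain t where t: "x = of_real t" "real (Suc n) \<le> t" using T by blast
    hence t0: "t > 0" by simp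
    hence "x \<notin> \<real>\<^sub>\<le>\<^sub>0" using t by (auto simp: complex_nonpos_Reals_iff)
    thus "((\<lambda>x. x powr - z) has_field_derivative (- z * x powr (- z - 1))) (at x within T)"
      by (rule has_field_derivative_at_within[OF has_field_derivative_powr])
    have "norm (x powr (- z - 1)) = t powr (- Re z - 1)"
      using t t0 by (simp add: norm_powr_real_powr)
    also have "\<dots> \<le> real (Suc n) powr (- Re z - 1)" using t assms by (intro powr_mono2') auto
    finally show "norm (- z * x powr (- z - 1)) \<le> norm z * real (Suc n) powr (- Re z - 1)"
      by (simp add: norm_mult mult_left_mono)
  qed
  thus ?thesis by simp
qed

text \<open>Abel summation replaces the series by the summands \<open>t n z\<close>, of size about
  \<open>n powr (- Re z - 1)\<close>. These converge locally uniformly for \<open>Re z > 0\<close>,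
  so their sum is holomorphic there.\<close>

lemma dirichlet_L_on_of_bounded_sums:
  assumes bd: "\<And>N. norm (\<Sum>n=1..N. chi n :: complex) \<le> B"
  obtains f where "dirichlet_L_on chi 0 f"
    "\<And>z. Re z > 0 \<Longrightarrow> (\<lambda>n. chi (Suc n) * of_nat (Suc n) powr - z) sums f z"
proof -
  define A where "A N = (\<Sum>n=1..N. chi n)" for N
  define t where "t n z = A (Suc n) * (of_nat (Suc n) powr - z - of_nat (Suc (Suc n)) powr - z)" for n and z :: complex
  define f where "f z = (\<Sum>n. t n z)" for z
  have B0: "B \<ge> 0" using bd[of 0] by simp
  have t_le: "norm (t n z) \<le> B * (norm z * real (Suc n) powr (- Re z - 1))" if "Re z > 0" for n z
    unfolding t_def norm_mult A_def by (intro mult_mono norm_powr_diff_le[OF that] bd) (use B0 in auto)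
  \<comment> \<open>On the disc of radius \<open>Re z / 2\<close> real parts stay at least
    \<open>Re z / 2\<close>, so one summable majorant serves the whole disc.\<close>
  have unif: "uniform_limit (cball z (Re z / 2)) (\<lambda>N z. \<Sum>n<N. t n z) f sequentially" if z: "Re z > 0" for z
    unfolding f_def
  proof (rule Weierstrass_m_test)
    fix n y assume y: "y \<in> cball z (Re z / 2)"
    have "norm (z - y) \<le> Re z / 2" using y by (simp add: dist_norm)
    hence "Re (z - y) \<le> Re z / 2" using complex_Re_le_cmod order_trans by blast
    hence Re_y: "Re y \<ge> Re z / 2" unfolding minus_complex.sel by linarith
    have "norm y \<le> norm z + Re z / 2"
      using \<open>norm (z - y) \<le> Re z / 2\<close> norm_triangle_ineq3[of z y] by linarith
    hence "norm y * real (Suc n) powr (- Re y - 1) \<le> (norm z + Re z / 2) * real (Suc n) powr (- Re z / 2 - 1)"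
      using Re_y z by (intro mult_mono powr_mono) auto
    thus "norm (t n y) \<le> B * ((norm z + Re z / 2) * real (Suc n) powr (- Re z / 2 - 1))"
      using t_le[of y n] Re_y z B0 by (meson mult_left_mono order_trans less_le_trans half_gt_zero)
  next
    have "summable (\<lambda>n. real n powr (- Re z / 2 - 1))" using z by (simp add: summable_real_powr_iff)
    hence "summable (\<lambda>n. real (Suc n) powr (- Re z / 2 - 1))" by (subst summable_Suc_iff)
    thus "summable (\<lambda>n. B * ((norm z + Re z / 2) * real (Suc n) powr (- Re z / 2 - 1)))"
      by (intro summable_mult)
  qed
  have hol: "f holomorphic_on {z. Re z > 0}"
  proof (rule holomorphic_uniform_sequence)
    show "open {z. Re z > 0}" by (rule open_halfspace_Re_gt)
    show "(\<lambda>z. \<Sum>n<N. t n z) holomorphic_on {z. Re z > 0}" for N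
      unfolding t_def by (intro holomorphic_intros) (auto simp del: of_nat_Suc)
    fix z assume z: "z \<in> {z. Re z > 0}"
    have "cball z (Re z / 2) \<subseteq> {z. Re z > 0}"
    proof
      fix y assume "y \<in> cball z (Re z / 2)"
      hence "Re (z - y) \<le> Re z / 2" using complex_Re_le_cmod order_trans by (metis dist_norm mem_cball)
      thus "y \<in> {z. Re z > 0}" using z unfolding minus_complex.sel mem_Collect_eq by linarith
    qed
    thus "\<exists>d>0. cball z d \<subseteq> {z. Re z > 0} \<and> uniform_limit (cball z d) (\<lambda>N z. \<Sum>n<N. t n z) f sequentially"
      using unif[of z] z by (intro exI[of _ "Re z / 2"]) auto
  qed
  have sums: "(\<lambda>n. chi (Suc n) * of_nat (Suc n) powr - z) sums f z" if z: "Re z > 0" for z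
  proof -
    \<comment> \<open>The boundary term of the Abel summation tends to 0, so the original series has
      the same sum.\<close>
    have partial: "(\<Sum>n<N. chi (Suc n) * of_nat (Suc n) powr - z) =
        (\<Sum>n<N. t n z) + A N * of_nat (Suc N) powr - z" for N
      by (induction N) (simp_all add: t_def A_def algebra_simps)
    have "(\<lambda>N. \<Sum>n<N. t n z) \<longlonglongrightarrow> f z"
      using z by (intro tendsto_uniform_limitI[OF unif]) auto
    moreover have "(\<lambda>N. A N * of_nat (Suc N) powr - z) \<longlonglongrightarrow> 0"
    proof (rule Lim_null_comparison)
      show "\<forall>\<^sub>F N in sequentially. norm (A N * of_nat (Suc N) powr - z) \<le> B * real (Suc N) powr - Re z"
      proof (rule always_eventually, rule allI)
        fix N
        have "norm (of_nat (Suc N) powr - z :: complex) = real (Suc N) powr - Re z"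
          using norm_powr_real_powr[of "of_nat (Suc N)" "- z"] by simp
        thus "norm (A N * of_nat (Suc N) powr - z) \<le> B * real (Suc N) powr - Re z"
          unfolding norm_mult A_def using bd[of N] by (simp add: mult_right_mono)
      qed
      have "(\<lambda>N. B * real (Suc N) powr - Re z) \<longlonglongrightarrow> B * 0"
        by (intro tendsto_mult tendsto_const tendsto_neg_powr filterlim_compose[OF filterlim_real_sequentially filterlim_Suc])
          (use z in simp)
      thus "(\<lambda>N. B * real (Suc N) powr - Re z) \<longlonglongrightarrow> 0" by simp
    qed
    ultimately show ?thesis unfolding sums_def partial using tendsto_add by fastforce
  qed
  have "dirichlet_L_on chi 0 f" unfolding dirichlet_L_on_def using hol sums by simp
  with sums show ?thesis using that by blast
qed

section \<open>Values and bounded sums of Dirichlet characters\<close>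

lemma dirichlet_character_cong:
  assumes "dirichlet_character D chi" "[m = n] (mod D)"
  shows "chi m = chi n"
proof -
  have per: "chi (n + D) = chi n" for n using assms by (simp add: dirichlet_character_def)
  have "chi (n + k * D) = chi n" for n k
  proof (induction k)
    case (Suc k)
    have "chi (n + Suc k * D) = chi ((n + k * D) + D)" by (simp add: algebra_simps)
    thus ?case using per Suc by simp
  qed simp
  hence "chi n = chi (n mod D)" for n by (metis mod_div_mult_eq)
  thus ?thesis using assms(2) by (metis cong_def)
qed

lemma dirichlet_character_one:
  assumes "dirichlet_character D chi"
  shows "chi 1 = 1"
proof -
  have "chi 1 * chi 1 = chi 1" "chi 1 \<noteq> 0"
    using assms unfolding dirichlet_character_def by (metis mult_1, metis coprime_1_left)
  thus ?thesis by simp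
qed

text \<open>By Euler's theorem the value is a root of unity.\<close>

lemma norm_dirichlet_character:
  assumes "dirichlet_character D chi" "coprime n D"
  shows "norm (chi n) = 1"
proof -
  have D0: "D > 0" using assms by (simp add: dirichlet_character_def)
  have pw: "chi (n ^ k) = chi n ^ k" for k
    using assms dirichlet_character_one[OF assms(1)] by (induction k) (auto simp: dirichlet_character_def)
  have "[n ^ totient D = 1] (mod D)" using assms(2) by (rule euler_theorem)
  hence "chi n ^ totient D = 1"
    using dirichlet_character_cong[OF assms(1)] dirichlet_character_one[OF assms(1)] pw by metis
  hence "norm (chi n) ^ totient D = 1" by (metis norm_one norm_power)
  thus ?thesis using D0 power_eq_iff_eq_base[of "totient D" "norm (chi n)" 1] by simp
qed

text \<open>Otherwise \<open>chi\<close> would be induced by the trivial character modulo 1 and have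
  conductor at most 1.\<close>

lemma primitive_character_nonprincipal:
  assumes "primitive_character D chi" "D > 1"
  obtains a where "coprime a D" "chi a \<noteq> 1"
proof -
  have "\<exists>a. coprime a D \<and> chi a \<noteq> 1"
  proof (rule ccontr)
    assume "\<not> ?thesis"
    hence "1 dvd D \<and> (\<exists>\<psi>. dirichlet_character 1 \<psi> \<and> (\<forall>n. coprime n D \<longrightarrow> chi n = \<psi> n))"
      by (auto intro!: exI[of _ "\<lambda>_. 1"] simp: dirichlet_character_def)
    hence "conductor D chi \<le> 1" unfolding conductor_def by (rule Least_le)
    thus False using assms by (simp add: primitive_character_def)
  qed
  thus ?thesis using that by blast
qed

text \<open>Multiplication by \<open>a\<close> permutes the residues and multiplies the sum by
  \<open>chi a\<close>, which differs from 1.\<close>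

lemma sum_nonprincipal_character_period:
  assumes chi: "dirichlet_character D chi" and a: "coprime a D" "chi a \<noteq> 1"
  shows "(\<Sum>n<D. chi n) = 0"
proof -
  have D0: "D > 0" using chi by (simp add: dirichlet_character_def)
  have inj: "inj_on (\<lambda>n. a * n mod D) {..<D}"
  proof (rule inj_onI)
    fix m n assume mn: "m \<in> {..<D}" "n \<in> {..<D}" "a * m mod D = a * n mod D"
    hence "[m = n] (mod D)" using a(1) by (simp add: cong_def[symmetric] cong_mult_lcancel_nat)
    thus "m = n" using mn by (simp add: cong_def)
  qed
  have "bij_betw (\<lambda>n. a * n mod D) {..<D} {..<D}"
    unfolding bij_betw_def using D0 by (intro conjI inj endo_inj_surj) auto
  hence "(\<Sum>n<D. chi n) = (\<Sum>n<D. chi (a * n mod D))"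
    by (rule sum.reindex_bij_betw[symmetric])
  also have "\<dots> = (\<Sum>n<D. chi a * chi n)"
  proof (rule sum.cong)
    fix n
    have "chi (a * n mod D) = chi (a * n)" by (rule dirichlet_character_cong[OF chi]) simp
    thus "chi (a * n mod D) = chi a * chi n" using chi by (simp add: dirichlet_character_def)
  qed simp
  also have "\<dots> = chi a * (\<Sum>n<D. chi n)" by (simp add: sum_distrib_left)
  finally show ?thesis using a(2) by (metis mult_cancel_right1)
qed

text \<open>Full periods cancel, leaving at most \<open>D\<close> terms of norm at most 1.\<close>

lemma norm_sum_nonprincipal_character_le:
  assumes chi: "dirichlet_character D chi" and a: "coprime a D" "chi a \<noteq> 1"
  shows "norm (\<Sum>n<N. chi n) \<le> real D"
proof (induction N rule: less_induct)
  case (less N)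
  have D0: "D > 0" using chi by (simp add: dirichlet_character_def)
  show ?case
  proof (cases "N \<le> D")
    case True
    have "norm (chi n) \<le> 1" for n
      using norm_dirichlet_character[OF chi, of n] chi by (cases "coprime n D") (auto simp: dirichlet_character_def)
    hence "norm (\<Sum>n<N. chi n) \<le> of_nat (card {..<N}) * 1" by (intro sum_norm_bound)
    thus ?thesis using True by simp
  next
    case False
    have "(\<Sum>n<D + k. chi n) = (\<Sum>n<D. chi n) + (\<Sum>n<k. chi (n + D))" for k
      by (induction k) (simp_all add: add_ac)
    from this[of "N - D"] have "(\<Sum>n<N. chi n) = (\<Sum>n<D. chi n) + (\<Sum>n<N - D. chi (n + D))"
      using False by simp
    also have "\<dots> = (\<Sum>n<N - D. chi n)"
      using sum_nonprincipal_character_period[OF chi a] chi by (simp add: dirichlet_character_def)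
    finally show ?thesis using less[of "N - D"] False D0 by simp
  qed
qed

section \<open>Reduction of the complex statement to real arithmetic\<close>

theorem theorem2:
  shows "\<forall>C::real. C > 0 \<longrightarrow> (\<exists>C'::real. C' > 0 \<and>
    (\<forall>(D::nat) (chi::nat \<Rightarrow> complex) (\<beta>::real).
       D \<ge> 3 \<longrightarrow> real_primitive_character D chi \<longrightarrow>
       \<beta> < 1 \<longrightarrow> dirichlet_L chi (complex_of_real \<beta>) = 0 \<longrightarrow>
       1 - \<beta> \<le> C * ln (real D) powi (-3) * ln (ln (real D)) \<longrightarrow>
       Re (dirichlet_L chi 1) \<le> C' / ln (real D)))"
proof (intro allI impI)
  fix C :: real assume C: "C > 0"
  from eventually_parameters[OF C] obtain l0 where
    l0: "\<And>l. l \<ge> l0 \<Longrightarrow> C * ln l / l ^ 3 \<le> 1 / 8 \<and>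
     C * ln l / l ^ 3 * (40 * l * (41 + 40 * sqrt (ln l))) \<le> 1 / 2 \<and>
     l * (8 * (C * ln l / l ^ 3) * (40 * l * (41 + 40 * sqrt (ln l))) + 2 / exp l) < 1 \<and>
     2 * (41 + 40 * sqrt (ln l)) * ln (41 + 40 * sqrt (ln l)) < ln l \<and>
     1 + sqrt (ln l) \<le> l \<and> l \<ge> 4"
    unfolding eventually_at_top_linorder by blast
  \<comment> \<open>The first summand serves \<open>l \<ge> l0\<close>. The second bounds
    \<open>L1 * l \<le> 2 * D * l\<close> for \<open>l < l0\<close>; the absolute value keeps it
    nonnegative.\<close>
  define C' where "C' = 16 * exp 10 * C + 2 * exp l0 * \<bar>l0\<bar>"
  show "\<exists>C'>0. \<forall>D chi \<beta>. D \<ge> 3 \<longrightarrow> real_primitive_character D chi \<longrightarrow>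
       \<beta> < 1 \<longrightarrow> dirichlet_L chi (complex_of_real \<beta>) = 0 \<longrightarrow>
       1 - \<beta> \<le> C * ln (real D) powi (-3) * ln (ln (real D)) \<longrightarrow>
       Re (dirichlet_L chi 1) \<le> C' / ln (real D)"
  proof (intro exI[of _ C'] conjI allI impI)
    show "C' > 0" unfolding C'_def using C by (intro add_pos_nonneg) auto
    fix D :: nat and chi :: "nat \<Rightarrow> complex" and \<beta> :: real
    assume D3: "D \<ge> 3" and prim: "real_primitive_character D chi" and \<beta>: "\<beta> < 1"
      and zero: "dirichlet_L chi (complex_of_real \<beta>) = 0"
      and close: "1 - \<beta> \<le> C * ln (real D) powi (-3) * ln (ln (real D))"
    have chi: "dirichlet_character D chi" and pr: "primitive_character D chi" and re: "chi n \<in> \<real>" for n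
      using prim by (auto simp: real_primitive_character_def primitive_character_def)
    obtain a where a: "coprime a D" "chi a \<noteq> 1"
      using primitive_character_nonprincipal[OF pr] D3 by auto
    \<comment> \<open>Vanishing at 0 lets the sums over \<open>n < N + 1\<close> start at 1.\<close>
    have "\<not> coprime 0 D" using D3 by simp
    hence chi0: "chi 0 = 0" using chi unfolding dirichlet_character_def by blast
    have sum_bd: "norm (\<Sum>n=1..N. chi n) \<le> real D" for N
    proof -
      have "(\<Sum>n<Suc N. chi n) = (\<Sum>n=1..N. chi n)"
        using chi0 by (intro sum.mono_neutral_right) (auto simp: not_less_eq_eq)
      thus ?thesis using norm_sum_nonprincipal_character_le[OF chi a, of "Suc N"] by simp
    qed
    define c where "c n = Re (chi n)" for n
    have chi_c: "chi n = of_real (c n)" for n using re[of n] by (simp add: c_def)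
    interpret real_character D c
    proof
      show "D \<ge> 1" using D3 by simp
      show "c (m * n) = c m * c n" for m n
      proof -
        have "chi (m * n) = chi m * chi n" using chi by (simp add: dirichlet_character_def)
        hence "complex_of_real (c (m * n)) = complex_of_real (c m * c n)"
          by (simp only: chi_c of_real_mult)
        thus ?thesis by (simp only: of_real_eq_iff)
      qed
      show "c 1 = 1" using dirichlet_character_one[OF chi] by (simp add: c_def)
      show "c n \<in> {-1, 0, 1}" for n
      proof (cases "coprime n D")
        case True
        have "norm (chi n) = \<bar>c n\<bar>" by (subst chi_c) simp
        thus ?thesis using norm_dirichlet_character[OF chi True] by auto
      next
        case False
        hence "chi n = 0" using chi unfolding dirichlet_character_def by blast
        thus ?thesis by (simp add: c_def)
      qed
      show "\<bar>\<Sum>n=1..N. c n\<bar> \<le> real D" for N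
      proof -
        have "(\<Sum>n=1..N. chi n) = of_real (\<Sum>n=1..N. c n)" by (simp add: chi_c)
        thus ?thesis using sum_bd[of N] by (metis norm_of_real real_norm_def)
      qed
    qed
    obtain f where f: "dirichlet_L_on chi 0 f"
      "\<And>z. Re z > 0 \<Longrightarrow> (\<lambda>n. chi (Suc n) * of_nat (Suc n) powr - z) sums f z"
      using dirichlet_L_on_of_bounded_sums[OF sum_bd] by blast
    have L_sums: "(\<lambda>n. c (Suc n) * real (Suc n) powr - s) sums Re (dirichlet_L chi (of_real s))" if "s > 0" for s
    proof -
      have "(\<lambda>n. chi (Suc n) * of_nat (Suc n) powr - complex_of_real s) sums dirichlet_L chi (of_real s)"
        using f(2)[of "of_real s"] dirichlet_L_eqI[OF f(1), of "of_real s"] that by simp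
      hence "(\<lambda>n. Re (chi (Suc n) * of_nat (Suc n) powr - complex_of_real s)) sums Re (dirichlet_L chi (of_real s))"
        by (rule sums_Re)
      moreover have "chi (Suc n) * of_nat (Suc n) powr - complex_of_real s = of_real (c (Suc n) * real (Suc n) powr - s)" for n
        using powr_of_real[of "real (Suc n)" "- s"] by (simp add: chi_c)
      ultimately show ?thesis by (simp only: Re_complex_of_real)
    qed
    define L1 where "L1 = Re (dirichlet_L chi 1)"
    have L1: "(\<lambda>n. c (Suc n) / real (Suc n)) sums L1"
      using L_sums[of 1] by (simp add: L1_def powr_minus divide_inverse del: of_nat_Suc)
    define l where "l = ln (real D)"
    have l_pos: "l > 0" using D3 by (simp add: l_def)
    show "Re (dirichlet_L chi 1) \<le> C' / ln (real D)"
    proof (cases "l \<ge> l0")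
      case True
      note p = l0[OF True]
      define \<delta> where "\<delta> = 1 - \<beta>"
      have \<delta>: "0 < \<delta>" "\<delta> \<le> C * ln l / l ^ 3"
        using \<beta> close by (auto simp: \<delta>_def l_def power_int_minus field_simps)
      have "\<delta> \<le> 1/8" using \<delta>(2) conjunct1[OF p] by (rule order_trans)
      \<comment> \<open>Positivity of \<open>\<beta>\<close> ensures that the Dirichlet series
        itself converges to \<open>L\<close> at the zero.\<close>
      hence "\<beta> > 0" by (simp add: \<delta>_def)
      hence z: "(\<lambda>n. c (Suc n) * real (Suc n) powr (\<delta> - 1)) sums 0"
        using L_sums[of \<beta>] zero by (simp add: \<delta>_def)
      have "L1 \<le> 16 * exp 10 * C / l"
        using L1_bound_large[OF C \<delta>(1) _ L1 z] \<delta>(2) p unfolding l_def by blast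
      also have "\<dots> \<le> C' / l" using l_pos by (intro divide_right_mono) (auto simp: C'_def)
      finally show ?thesis by (simp add: L1_def l_def)
    next
      case False
      have "real D = exp l" using D3 by (simp add: l_def)
      hence "L1 \<le> 2 * exp l" using L1_le_2D[OF L1] by simp
      hence "L1 * l \<le> 2 * exp l * l" using l_pos by (intro mult_right_mono) auto
      also have "\<dots> \<le> 2 * exp l0 * \<bar>l0\<bar>" using False l_pos by (intro mult_mono) auto
      also have "\<dots> \<le> C'" using C by (simp add: C'_def)
      finally show ?thesis using l_pos by (simp add: L1_def l_def field_simps)
    qed
  qed
qed

end
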